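(* Let $Z_1,\dots,Z_{T+1}$ be a stochastic process with values in $\mathcal Z=\mathcal X\times\mathcal Y$, with $\mathbf Z_1^T=(Z_1,\dots,Z_T)$ distributed according to $\mathbf p$, let $\mathcal F$ be a family of loss functions on $\mathcal Z$ bounded by $M$, and let $\mathbf q=(q_1,\dots,q_T)\in\mathbb R^T$, $\mathbf q\neq 0$, be a fixed weight vector. Let $$\Phi(\mathbf Z_1^T)=\sup_{f\in\mathcal F}\Big(\mathbb E[f(Z_{T+1})\mid \mathbf Z_1^T]-\sum_{t=1}^T q_t f(Z_t)\Big),\qquad \mathrm{disc}(\mathbf q)=\sup_{f\in\mathcal F}\Big(\mathbb E[f(Z_{T+1})\mid\mathbf Z_1^T]-\sum_{t=1}^T q_t\,\mathbb E[f(Z_t)\mid\mathbf Z_1^{t-1}]\Big).$$ Fix $\epsilon>2\alpha>0$. Then $$\mathbb P\big(\Phi(\mathbf Z_1^T)-\mathrm{disc}(\mathbf q)\ge\epsilon\big)\le \mathbb E_{\mathbf v\sim T(\mathbf p)}\big[\mathcal N_1(\alpha,\mathcal F,\mathbf v)\big]\exp\Big(-\frac{(\epsilon-2\alpha)^2}{2M^2\|\mathbf q\|_2^2}\Big).$$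
   Context: Setting: $H$ is a set of hypotheses $h:\mathcal X\to\mathcal Y$, $L:\mathcal Y\times\mathcal Y\to[0,\infty)$ is a loss function, and $\mathcal F=\{(x,y)\mapsto L(h(x),y): h\in H\}$. It is assumed that $|f|\le M$ for all $f\in\mathcal F$ (so $0\le f\le M$). $\mathbf Z_a^b$ denotes $(Z_a,\dots,Z_b)$. The weights $q_t$ are arbitrary real numbers (not necessarily non-negative or summing to one). Trees: an $A$-valued complete binary tree of depth $T$ is a sequence $\mathbf z=(z_1,\dots,z_T)$ of maps $z_t:\{\pm1\}^{t-1}\to A$; for $\sigma\in\{\pm1\}^T$ write $z_t(\sigma)=z_t(\sigma_1,\dots,\sigma_{t-1})$. Sequential covers: a set $V$ of $\mathbb R$-valued trees of depth $T$ is a sequential $\alpha$-cover (with respect to the $\mathbf q$-weighted $\ell_1$ norm) of a class $\mathcal G$ of real functions on $\mathcal Z$ on a $\mathcal Z$-valued tree $\mathbf z$ if for all $g\in\mathcal G$ and $\sigma\in\{\pm1\}^T$ there is $\mathbf v\in V$ with $\sum_{t=1}^T|v_t(\sigma)-g(z_t(\sigma))|\le\|\mathbf q\|_\infty^{-1}\alpha$. $\mathcal N_1(\alpha,\mathcal G,\mathbf z)$ is the minimal size of such a cover. Random tree: let $\mathbf p_t(\cdot\mid z_1,\dots,z_{t-1})$ be the conditional distribution of $Z_t$ given the past. A random $\mathcal Z\times\mathcal Z$-valued tree is drawn recursively: at the root draw independent $Z_1,Z_1'\sim\mathbf p_1$; at the node reached by $(\sigma_1,\dots,\sigma_{t-1})$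 draw fresh independent $Z_t,Z_t'\sim\mathbf p_t(\cdot\mid S_1(\sigma_1),\dots,S_{t-1}(\sigma_{t-1}))$, where $S_i(1)=Z_i$ and $S_i(-1)=Z_i'$ are the values drawn at the ancestors along the path. $T(\mathbf p)$ is the distribution of the $\mathcal Z$-valued tree formed by the unprimed variables $Z_t$.
   Formalization: The family F is additionally assumed to be a measurable class: suprema over F of weighted sums of f(z_i) are measurable up to null sets of every law; without this the probability of Φ − disc ≥ ε can be undefined for uncountable F. *)

theory Defs
  imports "HOL-Probability.Probability"
begin

section \<open>Loss classes\<close>

definition loss_class :: "('y \<Rightarrow> 'y \<Rightarrow> real) \<Rightarrow> ('x \<Rightarrow> 'y) set \<Rightarrow> ('x \<times> 'y \<Rightarrow> real) set" where
  "loss_class L H = (\<lambda>h (x, y). L (h x) y) ` H"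

text \<open>
  Measurability of the class: for a possibly uncountable class, pointwise suprema of measurable
  functions need not be measurable. As usual in empirical process theory, a class is called
  measurable if the suprema of its weighted sums are measurable in the sample, where measurability
  is only required up to null sets of the law of the sample. Every countable class of uniformly
  bounded measurable functions has this property.
\<close>

definition measurable_class :: "'z measure \<Rightarrow> ('z \<Rightarrow> real) set \<Rightarrow> bool" where
  "measurable_class S F \<longleftrightarrow>
    (\<forall>(n::nat) (a::nat \<Rightarrow> real) \<mu>.
      prob_space \<mu> \<and> sets \<mu> = sets (\<Pi>\<^sub>M i\<in>{..<n}. S) \<longrightarrow>
      (\<lambda>z. SUP f\<in>F. \<Sum>i<n. a i * f (z i)) \<in> borel_measurable (completion \<mu>))"


section \<open>Conditional distributions of a process\<close>

definition past :: "(nat \<Rightarrow> 'w \<Rightarrow> 'z) \<Rightarrow> nat \<Rightarrow> 'w \<Rightarrow> nat \<Rightarrow> 'z" where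
  "past Z t \<omega> = (\<lambda>s\<in>{1..<t}. Z s \<omega>)"

text \<open>\<open>K\<close> is a regular conditional distribution of \<open>Z t\<close> given \<open>Z 1, \<dots>, Z (t - 1)\<close>.\<close>

definition cond_distribution ::
    "'w measure \<Rightarrow> 'z measure \<Rightarrow> (nat \<Rightarrow> 'w \<Rightarrow> 'z) \<Rightarrow> nat \<Rightarrow> ((nat \<Rightarrow> 'z) \<Rightarrow> 'z measure) \<Rightarrow> bool" where
  "cond_distribution P S Z t K \<longleftrightarrow>
    K \<in> (\<Pi>\<^sub>M s\<in>{1..<t}. S) \<rightarrow>\<^sub>M prob_algebra S \<and>
    (\<forall>B \<in> sets (\<Pi>\<^sub>M s\<in>{1..<t}. S). \<forall>A \<in> sets S.
      emeasure P {\<omega> \<in> space P. past Z t \<omega> \<in> B \<and> Z t \<omega> \<in> A} =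
      (\<integral>\<^sup>+\<omega>. emeasure (K (past Z t \<omega>)) A * indicator B (past Z t \<omega>) \<partial>P))"

text \<open>
  The conditional expectation of \<open>f (Z t)\<close> given \<open>Z 1, \<dots>, Z (t - 1)\<close>, in the version given by the
  conditional distributions \<open>p\<close>. Choosing one version simultaneously for all \<open>f\<close> is what makes
  pointwise suprema of conditional expectations over an uncountable class meaningful.
\<close>

definition cond_expectation ::
    "(nat \<Rightarrow> (nat \<Rightarrow> 'z) \<Rightarrow> 'z measure) \<Rightarrow> (nat \<Rightarrow> 'w \<Rightarrow> 'z) \<Rightarrow> nat \<Rightarrow> ('z \<Rightarrow> real) \<Rightarrow> 'w \<Rightarrow> real" where
  "cond_expectation p Z t f \<omega> = (\<integral>z. f z \<partial>p t (past Z t \<omega>))"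

lemma cond_expectation_eq_real_cond_exp:
  assumes P: "prob_space P"
    and Z: "\<And>s. s \<in> {1..t} \<Longrightarrow> Z s \<in> P \<rightarrow>\<^sub>M S" and t: "1 \<le> t"
    and K: "cond_distribution P S Z t (p t)"
    and f: "f \<in> borel_measurable S" and bound: "\<And>z. z \<in> space S \<Longrightarrow> \<bar>f z\<bar> \<le> B"
  shows "AE \<omega> in P. real_cond_exp P (vimage_algebra (space P) (past Z t) (\<Pi>\<^sub>M s\<in>{1..<t}. S))
    (\<lambda>\<omega>. f (Z t \<omega>)) \<omega> = cond_expectation p Z t f \<omega>"
proof -
  interpret prob_space P by fact
  let ?H = "\<Pi>\<^sub>M s\<in>{1..<t}. S"
  let ?V = "vimage_algebra (space P) (past Z t) ?H"
  have past: "past Z t \<in> P \<rightarrow>\<^sub>M ?H"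
    unfolding past_def by (intro measurable_restrict Z) auto
  have pastV: "past Z t \<in> ?V \<rightarrow>\<^sub>M ?H"
    using measurable_space[OF past] by (intro measurable_vimage_algebra1) auto
  have sub: "subalgebra P ?V"
    unfolding subalgebra_def using past
    by (auto simp: sets_vimage_algebra2 measurable_def)
  interpret finite_measure_subalgebra P ?V
    by standard (rule sub)
  have Zt: "Z t \<in> P \<rightarrow>\<^sub>M S" using t by (intro Z) auto
  have pt: "p t \<in> ?H \<rightarrow>\<^sub>M prob_algebra S" using K by (simp add: cond_distribution_def)
  have ce: "(\<lambda>h. \<integral>z. f z \<partial>p t h) \<in> borel_measurable ?H"
    using measurable_compose[OF measurable_prob_algebraD[OF pt] integral_measurable_subprob_algebra[OF f]]
    by simp

  have nn: "(\<integral>\<^sup>+\<omega>. indicator B (past Z t \<omega>) * g (Z t \<omega>) \<partial>P) =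
      (\<integral>\<^sup>+\<omega>. indicator B (past Z t \<omega>) * (\<integral>\<^sup>+z. g z \<partial>p t (past Z t \<omega>)) \<partial>P)"
    if B: "B \<in> sets ?H" and g: "g \<in> borel_measurable S" for B and g :: "_ \<Rightarrow> ennreal"
  proof -
    let ?D = "density P (\<lambda>\<omega>. indicator B (past Z t \<omega>))"
    have iB: "(\<lambda>\<omega>. indicator B (past Z t \<omega>) :: ennreal) \<in> borel_measurable P"
      using measurable_compose[OF past borel_measurable_indicator[OF B]] .
    have ne: "space ?D \<noteq> {}" by (simp add: not_empty)
    have k: "(\<lambda>\<omega>. p t (past Z t \<omega>)) \<in> ?D \<rightarrow>\<^sub>M subprob_algebra S"
      using measurable_compose[OF past measurable_prob_algebraD[OF pt]] by simp
    have "distr ?D S (Z t) = ?D \<bind> (\<lambda>\<omega>. p t (past Z t \<omega>))"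
    proof (rule measure_eqI)
      show "sets (distr ?D S (Z t)) = sets (?D \<bind> (\<lambda>\<omega>. p t (past Z t \<omega>)))"
        using sets_bind[OF sets_kernel[OF k] ne] by simp
      fix A assume "A \<in> sets (distr ?D S (Z t))"
      then have A: "A \<in> sets S" by simp
      have ev: "{\<omega> \<in> space P. past Z t \<omega> \<in> B \<and> Z t \<omega> \<in> A} \<in> sets P"
        using measurable_sets[OF past B] measurable_sets[OF Zt A]
        by (auto simp: vimage_def Int_def conj_ac dest: sets.Int)
      have "emeasure (distr ?D S (Z t)) A =
        (\<integral>\<^sup>+\<omega>. indicator B (past Z t \<omega>) * indicator (Z t -` A \<inter> space P) \<omega> \<partial>P)"
        using A Zt iB by (simp add: emeasure_distr emeasure_density measurable_sets)
      also have "\<dots> = (\<integral>\<^sup>+\<omega>. indicator {\<omega> \<in> space P. past Z t \<omega> \<in> B \<and> Z t \<omega> \<in> A} \<omega> \<partial>P)"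
        by (intro nn_integral_cong) (auto simp: indicator_def)
      also have "\<dots> = (\<integral>\<^sup>+\<omega>. emeasure (p t (past Z t \<omega>)) A * indicator B (past Z t \<omega>) \<partial>P)"
        using K A B ev by (simp add: cond_distribution_def)
      also have "\<dots> = (\<integral>\<^sup>+\<omega>. emeasure (p t (past Z t \<omega>)) A \<partial>?D)"
        using measurable_compose[OF k[simplified] measurable_emeasure_subprob_algebra[OF A]]
        by (subst nn_integral_density) (auto simp: iB mult.commute)
      also have "\<dots> = emeasure (?D \<bind> (\<lambda>\<omega>. p t (past Z t \<omega>))) A"
        by (rule emeasure_bind[OF ne k A, symmetric])
      finally show "emeasure (distr ?D S (Z t)) A = emeasure (?D \<bind> (\<lambda>\<omega>. p t (past Z t \<omega>))) A" .
    qed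
    then have "(\<integral>\<^sup>+z. g z \<partial>distr ?D S (Z t)) = (\<integral>\<^sup>+\<omega>. (\<integral>\<^sup>+z. g z \<partial>p t (past Z t \<omega>)) \<partial>?D)"
      using nn_integral_bind[OF g k] by simp
    moreover have "(\<lambda>\<omega>. \<integral>\<^sup>+z. g z \<partial>p t (past Z t \<omega>)) \<in> borel_measurable P"
      using measurable_compose[OF k[simplified] nn_integral_measurable_subprob_algebra[OF g]] .
    moreover have "(\<lambda>\<omega>. g (Z t \<omega>)) \<in> borel_measurable P"
      using measurable_compose[OF Zt g] .
    ultimately show ?thesis
      using Zt g iB by (simp add: nn_integral_distr nn_integral_density)
  qed
  have pspace: "prob_space (p t (past Z t \<omega>))" "sets (p t (past Z t \<omega>)) = sets S"
    if "\<omega> \<in> space P" for \<omega>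
    using measurable_space[OF pt measurable_space[OF past that]] by (auto simp: space_prob_algebra)
  have fZ: "(\<lambda>\<omega>. f (Z t \<omega>)) \<in> borel_measurable P" using measurable_compose[OF Zt f] .
  have eP: "cond_expectation p Z t f \<in> borel_measurable P"
    using measurable_compose[OF past ce] by (simp add: cond_expectation_def[abs_def])
  have bZ: "\<bar>f (Z t \<omega>)\<bar> \<le> B" if "\<omega> \<in> space P" for \<omega>
    using bound measurable_space[OF Zt that] by blast
  have intp: "integrable (p t (past Z t \<omega>)) f" if "\<omega> \<in> space P" for \<omega>
  proof -
    interpret p: prob_space "p t (past Z t \<omega>)" by (rule pspace(1)[OF that])
    show ?thesis
      using f sets_eq_imp_space_eq[OF pspace(2)[OF that]] bound
      by (intro p.integrable_const_bound[of _ B])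
         (auto simp: measurable_cong_sets[OF pspace(2)[OF that] refl])
  qed
  have be: "\<bar>cond_expectation p Z t f \<omega>\<bar> \<le> B" if "\<omega> \<in> space P" for \<omega>
  proof -
    interpret p: prob_space "p t (past Z t \<omega>)" by (rule pspace(1)[OF that])
    have sp: "space (p t (past Z t \<omega>)) = space S"
      by (rule sets_eq_imp_space_eq[OF pspace(2)[OF that]])
    have "- B \<le> f z \<and> f z \<le> B" if "z \<in> space S" for z using bound[OF that] by auto
    then have "AE z in p t (past Z t \<omega>). - B \<le> f z" "AE z in p t (past Z t \<omega>). f z \<le> B"
      by (auto intro!: AE_I2 simp: sp)
    then show ?thesis
      using p.integral_ge_const[OF intp[OF that], of "-B"] p.integral_le_const[OF intp[OF that], of B]
      by (auto simp: cond_expectation_def abs_le_iff)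
  qed
  show ?thesis
  proof (rule real_cond_exp_charact)
    show i1: "integrable P (\<lambda>\<omega>. f (Z t \<omega>))"
      using fZ bZ by (intro integrable_const_bound[of _ B]) auto
    show i2: "integrable P (cond_expectation p Z t f)"
      using eP be by (intro integrable_const_bound[of _ B]) auto
    show "cond_expectation p Z t f \<in> borel_measurable ?V"
      using measurable_compose[OF pastV ce] by (simp add: cond_expectation_def[abs_def])
    fix A assume "A \<in> sets ?V"
    then obtain C where C: "C \<in> sets ?H" "A = past Z t -` C \<inter> space P"
      using past by (auto simp: sets_vimage_algebra2 measurable_def)
    have AP: "A \<in> sets P" using C measurable_sets[OF past C(1)] by simp
    have B0: "indicator C (past Z t \<omega>) = (indicator A \<omega> :: ennreal)" if "\<omega> \<in> space P" for \<omega>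
      using that C by (auto simp: indicator_def)
    have eq: "(\<integral>\<^sup>+\<omega>. ennreal (indicator A \<omega> * (f (Z t \<omega>) + B)) \<partial>P)
       = (\<integral>\<^sup>+\<omega>. ennreal (indicator A \<omega> * (cond_expectation p Z t f \<omega> + B)) \<partial>P)"
    proof -
      have m: "(\<lambda>z. ennreal (f z + B)) \<in> borel_measurable S" using f by simp
      have "(\<integral>\<^sup>+\<omega>. ennreal (indicator A \<omega> * (f (Z t \<omega>) + B)) \<partial>P) =
        (\<integral>\<^sup>+\<omega>. indicator C (past Z t \<omega>) * ennreal (f (Z t \<omega>) + B) \<partial>P)"
        by (intro nn_integral_cong) (auto simp: C(2) indicator_def)
      also have "\<dots> = (\<integral>\<^sup>+\<omega>. indicator C (past Z t \<omega>) * (\<integral>\<^sup>+z. ennreal (f z + B) \<partial>p t (past Z t \<omega>)) \<partial>P)"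
        by (rule nn[OF C(1) m])
      also have "\<dots> = (\<integral>\<^sup>+\<omega>. ennreal (indicator A \<omega> * (cond_expectation p Z t f \<omega> + B)) \<partial>P)"
      proof (rule nn_integral_cong)
        fix \<omega> assume w: "\<omega> \<in> space P"
        interpret p: prob_space "p t (past Z t \<omega>)" by (rule pspace(1)[OF w])
        have sp: "space (p t (past Z t \<omega>)) = space S"
          by (rule sets_eq_imp_space_eq[OF pspace(2)[OF w]])
        have nonneg: "0 \<le> f z + B" if "z \<in> space S" for z using bound[OF that] by auto
        have "(\<integral>\<^sup>+z. ennreal (f z + B) \<partial>p t (past Z t \<omega>)) =
          ennreal (\<integral>z. f z + B \<partial>p t (past Z t \<omega>))"
          using intp[OF w] nonneg by (intro nn_integral_eq_integral) (auto simp: sp)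
        also have "(\<integral>z. f z + B \<partial>p t (past Z t \<omega>)) = cond_expectation p Z t f \<omega> + B"
          using intp[OF w] by (simp add: cond_expectation_def p.prob_space)
        finally show "indicator C (past Z t \<omega>) * (\<integral>\<^sup>+z. ennreal (f z + B) \<partial>p t (past Z t \<omega>)) =
          ennreal (indicator A \<omega> * (cond_expectation p Z t f \<omega> + B))"
          using w by (auto simp: C(2) indicator_def)
      qed
      finally show ?thesis .
    qed
    have iA: "integrable P (\<lambda>\<omega>. indicator A \<omega> * h \<omega>)" if "integrable P h" for h :: "_ \<Rightarrow> real"
      using integrable_mult_indicator[OF AP that] by simp
    have nf: "0 \<le> indicator A \<omega> * (f (Z t \<omega>) + B)" if "\<omega> \<in> space P" for \<omega>
      using bZ[OF that] by (auto simp: indicator_def)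
    have ne: "0 \<le> indicator A \<omega> * (cond_expectation p Z t f \<omega> + B)" if "\<omega> \<in> space P" for \<omega>
      using be[OF that] by (auto simp: indicator_def)
    have "(\<integral>\<omega>. indicator A \<omega> * (f (Z t \<omega>) + B) \<partial>P) =
      (\<integral>\<omega>. indicator A \<omega> * (cond_expectation p Z t f \<omega> + B) \<partial>P)"
      using eq nn_integral_eq_integral[OF iA[of "\<lambda>\<omega>. f (Z t \<omega>) + B"]]
        nn_integral_eq_integral[OF iA[of "\<lambda>\<omega>. cond_expectation p Z t f \<omega> + B"]] i1 i2 nf ne
      by (simp add: integral_nonneg_AE)
    then show "(\<integral>x\<in>A. f (Z t x) \<partial>P) = (\<integral>x\<in>A. cond_expectation p Z t f x \<partial>P)"
      using iA[OF i1] iA[OF i2] iA[of "\<lambda>_. B"]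
      by (simp add: set_lebesgue_integral_def algebra_simps)
  qed
qed

definition Phi ::
    "(nat \<Rightarrow> (nat \<Rightarrow> 'z) \<Rightarrow> 'z measure) \<Rightarrow> (nat \<Rightarrow> 'w \<Rightarrow> 'z) \<Rightarrow> nat \<Rightarrow> ('z \<Rightarrow> real) set \<Rightarrow>
      (nat \<Rightarrow> real) \<Rightarrow> 'w \<Rightarrow> real" where
  "Phi p Z T F q \<omega> =
    (SUP f\<in>F. cond_expectation p Z (T + 1) f \<omega> - (\<Sum>t=1..T. q t * f (Z t \<omega>)))"

definition disc ::
    "(nat \<Rightarrow> (nat \<Rightarrow> 'z) \<Rightarrow> 'z measure) \<Rightarrow> (nat \<Rightarrow> 'w \<Rightarrow> 'z) \<Rightarrow> nat \<Rightarrow> ('z \<Rightarrow> real) set \<Rightarrow>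
      (nat \<Rightarrow> real) \<Rightarrow> 'w \<Rightarrow> real" where
  "disc p Z T F q \<omega> =
    (SUP f\<in>F. cond_expectation p Z (T + 1) f \<omega> -
      (\<Sum>t=1..T. q t * cond_expectation p Z t f \<omega>))"


section \<open>Trees and sequential covers\<close>

text \<open>
  The signs \<open>+1\<close> and \<open>-1\<close> are encoded as \<open>True\<close> and \<open>False\<close>. The maps \<open>z\<^sub>1, \<dots>, z\<^sub>T\<close> constituting a
  tree of depth \<open>T\<close> are merged into one function on the sign sequences of length less than \<open>T\<close>:
  the map \<open>z\<^sub>t\<close> is its restriction to the sequences of length \<open>t - 1\<close>.
\<close>

definition nodes :: "nat \<Rightarrow> bool list set" where
  "nodes T = {s. length s < T}"

definition label :: "(bool list \<Rightarrow> 'a) \<Rightarrow> nat \<Rightarrow> bool list \<Rightarrow> 'a" where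
  "label z t \<sigma> = z (take (t - 1) \<sigma>)"

definition sup_norm :: "nat \<Rightarrow> (nat \<Rightarrow> real) \<Rightarrow> real" where
  "sup_norm T q = (MAX t\<in>{1..T}. \<bar>q t\<bar>)"

definition seq_cover ::
    "nat \<Rightarrow> (nat \<Rightarrow> real) \<Rightarrow> real \<Rightarrow> ('z \<Rightarrow> real) set \<Rightarrow> (bool list \<Rightarrow> 'z) \<Rightarrow>
      (bool list \<Rightarrow> real) set \<Rightarrow> bool" where
  "seq_cover T q \<alpha> G z V \<longleftrightarrow>
    V \<subseteq> extensional (nodes T) \<and>
    (\<forall>g\<in>G. \<forall>\<sigma>. length \<sigma> = T \<longrightarrow>
      (\<exists>v\<in>V. (\<Sum>t=1..T. \<bar>label v t \<sigma> - g (label z t \<sigma>)\<bar>) \<le> inverse (sup_norm T q) * \<alpha>))"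

text \<open>The covering number is \<open>\<infinity>\<close> if there is no finite cover.\<close>

definition covering_number ::
    "nat \<Rightarrow> (nat \<Rightarrow> real) \<Rightarrow> real \<Rightarrow> ('z \<Rightarrow> real) set \<Rightarrow> (bool list \<Rightarrow> 'z) \<Rightarrow> enat" where
  "covering_number T q \<alpha> G z = (INF V\<in>{V. finite V \<and> seq_cover T q \<alpha> G z V}. enat (card V))"


section \<open>The random tree\<close>

text \<open>The tree with the given root label and subtrees \<open>l\<close> (for \<open>+1\<close>) and \<open>r\<close> (for \<open>-1\<close>) of depth \<open>n\<close>.\<close>

definition graft :: "nat \<Rightarrow> 'a \<Rightarrow> (bool list \<Rightarrow> 'a) \<Rightarrow> (bool list \<Rightarrow> 'a) \<Rightarrow> bool list \<Rightarrow> 'a" where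
  "graft n a l r =
    (\<lambda>s\<in>nodes (Suc n). case s of [] \<Rightarrow> a | b # s' \<Rightarrow> if b then l s' else r s')"

text \<open>
  \<open>pair_tree_law S p n t h\<close> is the law of the random tree of pairs of depth \<open>n\<close> whose root is drawn
  at time \<open>t\<close>, given that the history selected at times \<open>1, \<dots>, t - 1\<close> is \<open>h\<close>. The history is extended
  by the first component of the root in the \<open>+1\<close> subtree and by the second one in the \<open>-1\<close> subtree.
\<close>

primrec pair_tree_law ::
    "'z measure \<Rightarrow> (nat \<Rightarrow> (nat \<Rightarrow> 'z) \<Rightarrow> 'z measure) \<Rightarrow> nat \<Rightarrow> nat \<Rightarrow> (nat \<Rightarrow> 'z) \<Rightarrow>
      (bool list \<Rightarrow> 'z \<times> 'z) measure" where
  "pair_tree_law S p 0 t h = return (\<Pi>\<^sub>M s\<in>nodes 0. S \<Otimes>\<^sub>M S) (\<lambda>_. undefined)"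
| "pair_tree_law S p (Suc n) t h =
    do {
      z \<leftarrow> p t h;
      z' \<leftarrow> p t h;
      l \<leftarrow> pair_tree_law S p n (Suc t) (h(t := z));
      r \<leftarrow> pair_tree_law S p n (Suc t) (h(t := z'));
      return (\<Pi>\<^sub>M s\<in>nodes (Suc n). S \<Otimes>\<^sub>M S) (graft n (z, z') l r)
    }"

definition tree_law ::
    "'z measure \<Rightarrow> (nat \<Rightarrow> (nat \<Rightarrow> 'z) \<Rightarrow> 'z measure) \<Rightarrow> nat \<Rightarrow> (bool list \<Rightarrow> 'z) measure" where
  "tree_law S p T =
    distr (pair_tree_law S p T 1 (\<lambda>_. undefined)) (\<Pi>\<^sub>M s\<in>nodes T. S) (\<lambda>w. \<lambda>s\<in>nodes T. fst (w s))"


lemma graft_measurable: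
  "(\<lambda>x. graft n (fst x) (fst (snd x)) (snd (snd x)))
    \<in> N \<Otimes>\<^sub>M ((\<Pi>\<^sub>M s\<in>nodes n. N) \<Otimes>\<^sub>M (\<Pi>\<^sub>M s\<in>nodes n. N)) \<rightarrow>\<^sub>M (\<Pi>\<^sub>M s\<in>nodes (Suc n). N)"
  unfolding graft_def
proof (rule measurable_restrict)
  fix s assume s: "s \<in> nodes (Suc n)"
  show "(\<lambda>x. case s of [] \<Rightarrow> fst x | b # s' \<Rightarrow> if b then fst (snd x) s' else snd (snd x) s')
     \<in> N \<Otimes>\<^sub>M ((\<Pi>\<^sub>M s\<in>nodes n. N) \<Otimes>\<^sub>M (\<Pi>\<^sub>M s\<in>nodes n. N)) \<rightarrow>\<^sub>M N"
  proof (cases s)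
    case Nil
    then show ?thesis by simp
  next
    case (Cons b s')
    with s have *: "s' \<in> nodes n" by (simp add: nodes_def)
    have c: "(\<lambda>w. w s') \<in> (\<Pi>\<^sub>M s\<in>nodes n. N) \<rightarrow>\<^sub>M N"
      using measurable_component_singleton[OF *, of "\<lambda>_. N"] by simp
    show ?thesis
      by (cases b) (auto simp: Cons intro!: measurable_compose[OF _ c])
  qed
qed

lemma update_measurable:
  assumes "1 \<le> (t::nat)"
  shows "(\<lambda>x. (fst x)(t := snd x)) \<in> (\<Pi>\<^sub>M s\<in>{1..<t}. S) \<Otimes>\<^sub>M S \<rightarrow>\<^sub>M (\<Pi>\<^sub>M s\<in>{1..<Suc t}. S)"
proof -
  have "insert t {1..<t} = {1..<Suc t}" using assms by auto
  moreover have "(\<lambda>x. (fst x)(t := snd x)) \<in> (\<Pi>\<^sub>M s\<in>{1..<t}. S) \<Otimes>\<^sub>M S \<rightarrow>\<^sub>M (\<Pi>\<^sub>M s\<in>insert t {1..<t}. S)"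
    using measurable_add_dim[of t "{1..<t}" "\<lambda>_. S"] by (simp add: case_prod_beta')
  ultimately show ?thesis by simp
qed

lemma measurable_pair_tree_law:
  assumes K: "\<And>t. t \<in> {1..T} \<Longrightarrow> p t \<in> (\<Pi>\<^sub>M s\<in>{1..<t}. S) \<rightarrow>\<^sub>M prob_algebra S"
  shows "1 \<le> t \<Longrightarrow> t + n \<le> T + 1 \<Longrightarrow>
    pair_tree_law S p n t \<in> (\<Pi>\<^sub>M s\<in>{1..<t}. S) \<rightarrow>\<^sub>M prob_algebra (\<Pi>\<^sub>M s\<in>nodes n. S \<Otimes>\<^sub>M S)"
proof (induction n arbitrary: t)
  case 0
  have "return (\<Pi>\<^sub>M s\<in>nodes 0. S \<Otimes>\<^sub>M S) (\<lambda>_. undefined)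
    \<in> space (prob_algebra (\<Pi>\<^sub>M s\<in>nodes 0. S \<Otimes>\<^sub>M S))"
    by (intro measurable_space[OF measurable_return_prob_space])
       (simp add: nodes_def space_PiM)
  then show ?case by simp
next
  case (Suc n)
  let ?H = "\<Pi>\<^sub>M s\<in>{1..<t}. S" and ?N = "\<Pi>\<^sub>M s\<in>nodes n. S \<Otimes>\<^sub>M S"
  have pt: "p t \<in> ?H \<rightarrow>\<^sub>M prob_algebra S" using Suc.prems by (intro K) auto
  have IH: "pair_tree_law S p n (Suc t) \<in> (\<Pi>\<^sub>M s\<in>{1..<Suc t}. S) \<rightarrow>\<^sub>M prob_algebra ?N"
    using Suc.prems by (intro Suc.IH) auto
  have u: "(\<lambda>x. (a x)(t := b x)) \<in> R \<rightarrow>\<^sub>M (\<Pi>\<^sub>M s\<in>{1..<Suc t}. S)"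
    if "a \<in> R \<rightarrow>\<^sub>M ?H" "b \<in> R \<rightarrow>\<^sub>M S" for a b and R :: "'c measure"
    using measurable_compose[OF measurable_Pair[OF that] update_measurable[OF \<open>1 \<le> t\<close>]]
    by simp
  have g: "(\<lambda>x. graft n (a x) (l x) (r x)) \<in> R \<rightarrow>\<^sub>M (\<Pi>\<^sub>M s\<in>nodes (Suc n). S \<Otimes>\<^sub>M S)"
    if "a \<in> R \<rightarrow>\<^sub>M S \<Otimes>\<^sub>M S" "l \<in> R \<rightarrow>\<^sub>M ?N" "r \<in> R \<rightarrow>\<^sub>M ?N" for a l r and R :: "'c measure"
    using measurable_compose[OF measurable_Pair[OF that(1) measurable_Pair[OF that(2,3)]] graft_measurable]
    by simp
  have e: "(\<lambda>h. p t h \<bind> (\<lambda>z. p t h \<bind> (\<lambda>z'. pair_tree_law S p n (Suc t) (h(t := z)) \<bind>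
      (\<lambda>l. pair_tree_law S p n (Suc t) (h(t := z')) \<bind>
      (\<lambda>r. return (\<Pi>\<^sub>M s\<in>nodes (Suc n). S \<Otimes>\<^sub>M S) (graft n (z, z') l r))))))
    \<in> ?H \<rightarrow>\<^sub>M prob_algebra (\<Pi>\<^sub>M s\<in>nodes (Suc n). S \<Otimes>\<^sub>M S)"
    apply (rule measurable_bind_prob_space2[OF pt])
    apply (simp only: case_prod_beta')
    apply (rule measurable_bind_prob_space2[where N=S])
     apply (rule measurable_compose[OF measurable_fst pt])
    apply (simp only: case_prod_beta')
    apply (rule measurable_bind_prob_space2[where N="?N"])
     apply (rule measurable_compose[OF _ IH], rule u)
      apply simp apply simp
    apply (simp only: case_prod_beta')
    apply (rule measurable_bind_prob_space2[where N="?N"])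
     apply (rule measurable_compose[OF _ IH], rule u)
      apply simp apply simp
    apply (simp only: case_prod_beta')
    apply (rule measurable_compose[OF _ measurable_return_prob_space], rule g)
      apply simp_all
    done
  have "pair_tree_law S p (Suc n) t = (\<lambda>h. p t h \<bind> (\<lambda>z. p t h \<bind> (\<lambda>z'. pair_tree_law S p n (Suc t) (h(t := z)) \<bind>
      (\<lambda>l. pair_tree_law S p n (Suc t) (h(t := z')) \<bind>
      (\<lambda>r. return (\<Pi>\<^sub>M s\<in>nodes (Suc n). S \<Otimes>\<^sub>M S) (graft n (z, z') l r))))))"
    by (rule ext) simp
  with e show ?case by (simp only:)
qed

lemma prob_space_tree_law:
  assumes K: "\<And>t. t \<in> {1..T} \<Longrightarrow> p t \<in> (\<Pi>\<^sub>M s\<in>{1..<t}. S) \<rightarrow>\<^sub>M prob_algebra S"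
  shows "prob_space (tree_law S p T)"
proof -
  have "(\<lambda>_. undefined) \<in> space (\<Pi>\<^sub>M s\<in>{1..<1::nat}. S)" by (simp add: space_PiM)
  from measurable_space[OF measurable_pair_tree_law[OF K] this, of T] 
  have *: "prob_space (pair_tree_law S p T 1 (\<lambda>_. undefined))"
    "sets (pair_tree_law S p T 1 (\<lambda>_. undefined)) = sets (\<Pi>\<^sub>M s\<in>nodes T. S \<Otimes>\<^sub>M S)"
    by (auto simp: space_prob_algebra)
  have "(\<lambda>w. \<lambda>s\<in>nodes T. fst (w s)) \<in> (\<Pi>\<^sub>M s\<in>nodes T. S \<Otimes>\<^sub>M S) \<rightarrow>\<^sub>M (\<Pi>\<^sub>M s\<in>nodes T. S)"
    by measurable
  then show ?thesis unfolding tree_law_def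
    by (intro prob_space.prob_space_distr *) (simp only: measurable_cong_sets[OF *(2) refl])
qed


section \<open>Outer expectation\<close>

text \<open>
  The covering number of a random tree need not be measurable. For such functions
  \<^const>\<open>nn_integral\<close> would be a lower integral, whereas an upper bound requires the upper one; this
  is the counterpart of \<^const>\<open>outer_measure_of\<close> for functions.
\<close>

definition outer_expectation :: "'a measure \<Rightarrow> ('a \<Rightarrow> ennreal) \<Rightarrow> ennreal" where
  "outer_expectation M f =
    (INF g\<in>{g \<in> borel_measurable M. \<forall>x\<in>space M. f x \<le> g x}. \<integral>\<^sup>+x. g x \<partial>M)"

lemma outer_expectation_eq_nn_integral:
  assumes "f \<in> borel_measurable M"
  shows "outer_expectation M f = (\<integral>\<^sup>+x. f x \<partial>M)"
  unfolding outer_expectation_def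
  using assms by (intro INF_eqI) (auto intro!: nn_integral_mono)

end

theory Submission
  imports Defs
begin

text \<open>
  By subadditivity of suprema the deviation is at most the supremum over \<open>f\<close> of
  \<open>\<Sum>\<^sub>t q\<^sub>t (E[f(Z\<^sub>t) | past] - f(Z\<^sub>t))\<close>. Apply the Chernoff method with parameter \<open>\<lambda>\<close>. By Jensen's
  inequality the conditional expectations may be replaced by the values of a decoupled tangent
  sequence \<open>Z'\<^sub>t\<close>. For every sign sequence \<open>\<sigma>\<close>, the path of the random tree along \<open>\<sigma>\<close>, with the
  selected component put first, has the law of \<open>(Z, Z')\<close>, so one can average over \<open>\<sigma>\<close>. Convexity of
  the exponential function separates the two components; the tree of second components is a
  reflection of the tree of first components in law. For a fixed tree the supremum over \<open>f\<close> is
  replaced by a sum over a sequential cover, at the price \<open>2 \<lambda> \<alpha>\<close> in the exponent.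

  The constant in the exponent is obtained by centring: since \<open>0 \<le> f \<le> M\<close>, the class may be shifted
  by \<open>M / 2\<close> and the cover clipped to \<open>[0, M]\<close>, so that each sign is multiplied by a number of
  modulus at most \<open>\<lambda> |q\<^sub>t| M\<close>.
\<close>

section \<open>Exponential moments of sign sums along trees\<close>

text \<open>Signs cannot be put into the process directly: exchanging Z_t with Z'_t alters the
  history that all later kernels see. The tree stores both continuations, so an exchange becomes the
  choice of another path. Jensen, however, wants the Z' drawn once all of Z is known, while a path
  draws Z_t, Z'_t alternately; the two orders are shown to give the same integrals.

  Neither suprema over the class nor covering numbers need be measurable. The supremum is replaced
  by a Borel majorant, equal to it off a null set shared by all paths, the covering number by an
  arbitrary measurable majorant.

  Constants: midpoint convexity puts \<open>2 * l\<close> on either tree, whence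
  \<open>2 * l * \<alpha>\<close>. Centred clipped values have modulus at most \<open>M / 2\<close>,
  so the sign sum contributes \<open>l\<^sup>2 * Q / 2\<close> with
  \<open>Q = M\<^sup>2 * (L2_set q {1..T})\<^sup>2\<close>. The trees enter with weight 1/2 each and
  equal expectations, leaving one covering number. The exponent
  \<open>l\<^sup>2 * Q / 2 - l * (\<epsilon> - 2 * \<alpha>)\<close> is least at
  \<open>l = (\<epsilon> - 2 * \<alpha>) / Q\<close>.\<close>

lemma sum_bool_lists_Suc:
  fixes \<phi> :: "bool list \<Rightarrow> 'a::comm_monoid_add"
  shows "(\<Sum>\<sigma> | length \<sigma> = Suc n. \<phi> \<sigma>) =
    (\<Sum>\<sigma> | length \<sigma> = n. \<phi> (True # \<sigma>)) + (\<Sum>\<sigma> | length \<sigma> = n. \<phi> (False # \<sigma>))"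
proof -
  have fin: "finite {\<sigma>::bool list. length \<sigma> = n}"
    using finite_lists_length_eq[of "UNIV::bool set" n] by simp
  have "{\<sigma>::bool list. length \<sigma> = Suc n} =
      (#) True ` {\<sigma>. length \<sigma> = n} \<union> (#) False ` {\<sigma>. length \<sigma> = n}"
    by (auto simp: length_Suc_conv image_iff)
  moreover have "(#) True ` {\<sigma>. length \<sigma> = n} \<inter> (#) False ` {\<sigma>. length \<sigma> = n} = {}"
    by auto
  ultimately show ?thesis
    using fin by (simp add: sum.union_disjoint sum.reindex)
qed

abbreviation bool_sign :: "bool \<Rightarrow> real" where
  "bool_sign b \<equiv> (if b then 1 else - 1)"

text \<open>The left side is twice the moment generating function of a fair sign. Hoeffding's
  logarithmic estimate with success probability 1/2 and range \<open>2 * x\<close> gives the bound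
  for \<open>x \<ge> 0\<close>; both sides are even.\<close>

lemma exp_add_exp_minus_le: "exp x + exp (- x) \<le> 2 * exp (x\<^sup>2 / 2)" for x :: real
proof -
  have nonneg: "exp x + exp (- x) \<le> 2 * exp (x\<^sup>2 / 2)" if "0 \<le> x" for x :: real
  proof -
    have pos: "0 < 1 + 1 / 2 * (exp (2 * x) - 1)"
      using that by (simp add: add_pos_nonneg)
    have "- (2 * x) * (1 / 2) + ln (1 + 1 / 2 * (exp (2 * x) - 1)) \<le> (2 * x)\<^sup>2 / 8"
      using that by (intro Hoeffdings_lemma_aux) auto
    then have "exp (- x) * exp (ln (1 + 1 / 2 * (exp (2 * x) - 1))) \<le> exp (x\<^sup>2 / 2)"
      by (simp add: power_mult_distrib flip: exp_add)
    moreover have "exp (- x) * exp (2 * x) = exp x"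
      by (simp flip: exp_add)
    ultimately show ?thesis
      using pos by (simp add: field_simps)
  qed
  show ?thesis
    using nonneg[of x] nonneg[of "- x"] by (cases "0 \<le> x") auto
qed

text \<open>Once the first sign is fixed, the same kind of sum remains over the subtree below it.
  The two subtrees may carry different values, but \<open>c\<close> depends on the depth alone, so
  both receive the same estimate and the root contributes the factor
  \<open>exp (u []) + exp (- u [])\<close>.\<close>

lemma rademacher_tree_mgf:
  fixes u :: "bool list \<Rightarrow> real"
  assumes "\<And>s. \<bar>u s\<bar> \<le> c (length s)"
  shows "(\<Sum>\<sigma> | length \<sigma> = n. exp (\<Sum>i<n. bool_sign (\<sigma> ! i) * u (take i \<sigma>)))
    \<le> 2 ^ n * exp ((\<Sum>i<n. (c i)\<^sup>2) / 2)"
  using assms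
proof (induction n arbitrary: u c)
  case 0
  then show ?case by simp
next
  case (Suc n)
  let ?E = "2 ^ n * exp ((\<Sum>i<n. (c (Suc i))\<^sup>2) / 2)"
  have step: "(\<Sum>\<sigma> | length \<sigma> = n.
      exp (\<Sum>i<Suc n. bool_sign ((b # \<sigma>) ! i) * u (take i (b # \<sigma>)))) \<le> exp (bool_sign b * u []) * ?E" for b
  proof -
    have "(\<Sum>\<sigma> | length \<sigma> = n. exp (\<Sum>i<Suc n. bool_sign ((b # \<sigma>) ! i) * u (take i (b # \<sigma>)))) =
      exp (bool_sign b * u []) * (\<Sum>\<sigma> | length \<sigma> = n. exp (\<Sum>i<n. bool_sign (\<sigma> ! i) * u (b # take i \<sigma>)))"
      by (simp only: sum.lessThan_Suc_shift sum_distrib_left exp_add) simp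
    also have "\<dots> \<le> exp (bool_sign b * u []) * ?E"
      using Suc.prems[of "b # _"] by (intro mult_left_mono Suc.IH) auto
    finally show ?thesis .
  qed
  have "(u [])\<^sup>2 \<le> (c 0)\<^sup>2"
    using Suc.prems[of "[]"] by (simp add: abs_le_square_iff[symmetric])
  then have "exp (u []) + exp (- u []) \<le> 2 * exp ((c 0)\<^sup>2 / 2)"
    using exp_add_exp_minus_le[of "u []"] by (smt (verit) divide_right_mono exp_le_cancel_iff)
  then have "(exp (u []) + exp (- u [])) * ?E \<le> 2 * exp ((c 0)\<^sup>2 / 2) * ?E"
    by (intro mult_right_mono) auto
  also have "\<dots> = 2 ^ Suc n * exp ((\<Sum>i<Suc n. (c i)\<^sup>2) / 2)"
    by (simp only: sum.lessThan_Suc_shift add_divide_distrib exp_add) simp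
  finally show ?case
    using step[of True] step[of False] unfolding sum_bool_lists_Suc by (simp add: algebra_simps)
qed

section \<open>Sequential covers\<close>

text \<open>The coefficient of the sign at node \<open>s\<close> when a cover element stands in for
  a loss. Node \<open>s\<close> belongs to time \<open>Suc (length s)\<close>. Clipping and centring
  keep the bracket within \<open>M / 2\<close>; the factor 2 comes from midpoint convexity.\<close>

definition cover_exponent :: "(nat \<Rightarrow> real) \<Rightarrow> real \<Rightarrow> real \<Rightarrow> (bool list \<Rightarrow> real) \<Rightarrow> bool list \<Rightarrow> real" where
  "cover_exponent q M l v s = 2 * l * q (Suc (length s)) * (max 0 (min M (v s)) - M / 2)"

lemma cover_mgf:
  assumes "0 \<le> M"
  shows "(\<Sum>\<sigma> | length \<sigma> = n. exp (\<Sum>i<n. bool_sign (\<sigma> ! i) * cover_exponent q M l v (take i \<sigma>)))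
    \<le> 2 ^ n * exp (l\<^sup>2 * M\<^sup>2 * (L2_set q {1..n})\<^sup>2 / 2)"
proof -
  have "\<bar>cover_exponent q M l v s\<bar> \<le> \<bar>l\<bar> * \<bar>q (Suc (length s))\<bar> * M" for s
  proof -
    have "\<bar>max 0 (min M (v s)) - M / 2\<bar> \<le> M / 2"
      using assms by (auto simp: max_def min_def abs_if field_simps)
    then have "\<bar>2 * l * q (Suc (length s))\<bar> * \<bar>max 0 (min M (v s)) - M / 2\<bar>
        \<le> \<bar>2 * l * q (Suc (length s))\<bar> * (M / 2)"
      by (rule mult_left_mono) simp
    then show ?thesis
      by (simp add: cover_exponent_def abs_mult)
  qed
  note rademacher_tree_mgf[of "cover_exponent q M l v" "\<lambda>i. \<bar>l\<bar> * \<bar>q (Suc i)\<bar> * M" n, OF this]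
  moreover have "(\<Sum>i<n. (\<bar>l\<bar> * \<bar>q (Suc i)\<bar> * M)\<^sup>2) = l\<^sup>2 * M\<^sup>2 * (L2_set q {1..n})\<^sup>2"
    by (simp add: L2_set_def sum_nonneg power_mult_distrib sum_distrib_left sum_distrib_right
        sum.atLeast1_atMost_eq mult_ac)
  ultimately show ?thesis by simp
qed

lemma sup_norm_ge: "t \<in> {1..T} \<Longrightarrow> \<bar>q t\<bar> \<le> sup_norm T q"
  unfolding sup_norm_def by (intro Max_ge) auto

lemma sup_norm_pos: "\<exists>t\<in>{1..T}. q t \<noteq> 0 \<Longrightarrow> 0 < sup_norm T q"
  using sup_norm_ge[of _ T q] by fastforce

text \<open>The covering element depends on \<open>f\<close> and on the sign path, so the sum over
  all of \<open>V\<close> takes its place before any averaging over signs. Replacing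
  \<open>f\<close> by it changes the exponent by at most
  \<open>2 * \<bar>l\<bar> * sup_norm T q\<close> times their distance along the path, and the
  radius of the cover cancels the norm.\<close>

lemma exp_le_cover_sum:
  assumes V: "finite V" "seq_cover T q \<alpha> F z V" and f: "f \<in> F" and \<sigma>: "length \<sigma> = T"
    and bound: "\<And>s. s \<in> nodes T \<Longrightarrow> 0 \<le> f (z s) \<and> f (z s) \<le> M"
    and q: "\<exists>t\<in>{1..T}. q t \<noteq> 0"
  shows "exp (\<Sum>i<T. bool_sign (\<sigma> ! i) * (2 * l * q (Suc i) * (f (z (take i \<sigma>)) - M / 2)))
    \<le> exp (2 * \<bar>l\<bar> * \<alpha>) *
      (\<Sum>v\<in>V. exp (\<Sum>i<T. bool_sign (\<sigma> ! i) * cover_exponent q M l v (take i \<sigma>)))"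
proof -
  obtain v where v: "v \<in> V"
    "(\<Sum>i<T. \<bar>v (take i \<sigma>) - f (z (take i \<sigma>))\<bar>) \<le> inverse (sup_norm T q) * \<alpha>"
  proof -
    have "\<exists>v\<in>V. (\<Sum>t=1..T. \<bar>label v t \<sigma> - f (label z t \<sigma>)\<bar>) \<le> inverse (sup_norm T q) * \<alpha>"
      using V(2) f \<sigma> unfolding seq_cover_def by blast
    then show ?thesis
      using that by (auto simp: label_def sum.atLeast1_atMost_eq)
  qed
  have le: "bool_sign (\<sigma> ! i) * (2 * l * q (Suc i) * (f (z (take i \<sigma>)) - M / 2)) \<le>
     bool_sign (\<sigma> ! i) * cover_exponent q M l v (take i \<sigma>) +
     2 * \<bar>l\<bar> * sup_norm T q * \<bar>v (take i \<sigma>) - f (z (take i \<sigma>))\<bar>" if "i < T" for i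
  proof -
    define a where "a = f (z (take i \<sigma>))"
    define b where "b = max 0 (min M (v (take i \<sigma>)))"
    have "0 \<le> a" "a \<le> M"
      using bound[of "take i \<sigma>"] that \<sigma> by (auto simp: a_def nodes_def)
    \<comment> \<open>Clipping to [0, M] cannot move a number away from \<open>a\<close>, which
      already lies there.\<close>
    then have ab: "\<bar>a - b\<bar> \<le> \<bar>v (take i \<sigma>) - a\<bar>"
      by (auto simp: b_def max_def min_def abs_if)
    have "bool_sign (\<sigma> ! i) * (2 * l * q (Suc i) * (a - b)) \<le> \<bar>2 * l * q (Suc i)\<bar> * \<bar>a - b\<bar>"
      unfolding abs_mult[symmetric] by (cases "\<sigma> ! i") (simp_all add: abs_ge_self abs_ge_minus_self del: mult_minus_right)
    also have "\<dots> \<le> 2 * \<bar>l\<bar> * sup_norm T q * \<bar>v (take i \<sigma>) - a\<bar>"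
      using sup_norm_ge[of "Suc i" T q] that sup_norm_pos[OF q]
      by (intro mult_mono ab) (auto simp: abs_mult mult_left_mono)
    finally show ?thesis
      using \<sigma> that by (simp add: cover_exponent_def a_def b_def algebra_simps)
  qed
  have "(\<Sum>i<T. bool_sign (\<sigma> ! i) * (2 * l * q (Suc i) * (f (z (take i \<sigma>)) - M / 2))) \<le>
    (\<Sum>i<T. bool_sign (\<sigma> ! i) * cover_exponent q M l v (take i \<sigma>)) +
      2 * \<bar>l\<bar> * sup_norm T q * (\<Sum>i<T. \<bar>v (take i \<sigma>) - f (z (take i \<sigma>))\<bar>)"
    unfolding sum_distrib_left sum.distrib[symmetric] using le by (intro sum_mono) auto
  also have "\<dots> \<le> (\<Sum>i<T. bool_sign (\<sigma> ! i) * cover_exponent q M l v (take i \<sigma>)) +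
      2 * \<bar>l\<bar> * sup_norm T q * (inverse (sup_norm T q) * \<alpha>)"
    using sup_norm_pos[OF q] by (intro add_left_mono mult_left_mono v) auto
  also have "\<dots> = 2 * \<bar>l\<bar> * \<alpha> + (\<Sum>i<T. bool_sign (\<sigma> ! i) * cover_exponent q M l v (take i \<sigma>))"
    using sup_norm_pos[OF q] by simp
  finally have "exp (\<Sum>i<T. bool_sign (\<sigma> ! i) * (2 * l * q (Suc i) * (f (z (take i \<sigma>)) - M / 2))) \<le>
    exp (2 * \<bar>l\<bar> * \<alpha>) * exp (\<Sum>i<T. bool_sign (\<sigma> ! i) * cover_exponent q M l v (take i \<sigma>))"
    by (simp flip: exp_add)
  also have "\<dots> \<le> exp (2 * \<bar>l\<bar> * \<alpha>) *
      (\<Sum>v\<in>V. exp (\<Sum>i<T. bool_sign (\<sigma> ! i) * cover_exponent q M l v (take i \<sigma>)))"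
    using V(1) v(1)
    by (intro mult_left_mono member_le_sum[of v V "\<lambda>v. exp (\<Sum>i<T. bool_sign (\<sigma> ! i) * cover_exponent q M l v (take i \<sigma>))"]) auto
  finally show ?thesis .
qed

lemma exp_midpoint_le: "exp ((a + b) / 2) \<le> (exp a + exp b) / 2" for a b :: real
proof -
  have "0 \<le> (exp (a / 2) - exp (b / 2))\<^sup>2" by simp
  also have "\<dots> = exp a + exp b - 2 * exp ((a + b) / 2)"
    by (simp add: power2_diff add_divide_distrib exp_add[of "a / 2" "b / 2"] flip: exp_double)
  finally show ?thesis by simp
qed

text \<open>A term \<open>l * (f z' - f z)\<close> is the mean of
  \<open>2 * l * (f z' - M / 2)\<close> and \<open>2 * (- l) * (f z - M / 2)\<close>: the shift
  cancels, and convexity decouples the trees, so that each is treated with its own cover,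
  \<open>z'\<close> with parameter \<open>l\<close> and \<open>z\<close> with
  \<open>- l\<close>.\<close>

lemma symmetrized_mgf_le_cover:
  assumes V: "finite V" "seq_cover T q \<alpha> F z V" and V': "finite V'" "seq_cover T q \<alpha> F z' V'"
    and F: "F \<noteq> {}"
    and bound: "\<And>f s. f \<in> F \<Longrightarrow> s \<in> nodes T \<Longrightarrow> 0 \<le> f (z s) \<and> f (z s) \<le> M"
    and bound': "\<And>f s. f \<in> F \<Longrightarrow> s \<in> nodes T \<Longrightarrow> 0 \<le> f (z' s) \<and> f (z' s) \<le> M"
    and q: "\<exists>t\<in>{1..T}. q t \<noteq> 0" and l: "0 < l"
  shows "(\<Sum>\<sigma> | length \<sigma> = T. exp (l * (SUP f\<in>F.
      \<Sum>i<T. q (Suc i) * (bool_sign (\<sigma> ! i) * (f (z' (take i \<sigma>)) - f (z (take i \<sigma>)))))))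
    \<le> 2 ^ T * (exp (2 * l * \<alpha> + l\<^sup>2 * M\<^sup>2 * (L2_set q {1..T})\<^sup>2 / 2) / 2 * (card V + card V'))"
proof -
  define B where "B l V \<sigma> = exp (2 * \<bar>l\<bar> * \<alpha>) *
      (\<Sum>v\<in>V. exp (\<Sum>i<T. bool_sign (\<sigma> ! i) * cover_exponent q M l v (take i \<sigma>)))" for l V \<sigma>
  define E where "E = exp (l\<^sup>2 * M\<^sup>2 * (L2_set q {1..T})\<^sup>2 / 2)"
  obtain f0 where f0: "f0 \<in> F" using F by blast
  \<comment> \<open>A nonzero weight forces \<open>T \<ge> 1\<close>, so there is a root, and the
    loss there yields \<open>0 \<le> M\<close>.\<close>
  have "[] \<in> nodes T" using q by (auto simp: nodes_def)
  from bound[OF f0 this] have M: "0 \<le> M" by linarith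
  have sumB: "(\<Sum>\<sigma> | length \<sigma> = T. B l' W \<sigma>) \<le> 2 ^ T * (exp (2 * l * \<alpha>) * E * card W)"
    if "\<bar>l'\<bar> = l" for l' W
  proof -
    have "l'\<^sup>2 = l\<^sup>2"
      unfolding that[symmetric] by simp
    then have mgf: "(\<Sum>\<sigma> | length \<sigma> = T.
        exp (\<Sum>i<T. bool_sign (\<sigma> ! i) * cover_exponent q M l' v (take i \<sigma>))) \<le> 2 ^ T * E" for v
      using cover_mgf[OF M, where n=T and q=q and l=l' and v=v] by (simp only: E_def)
    have "(\<Sum>\<sigma> | length \<sigma> = T. B l' W \<sigma>) = exp (2 * l * \<alpha>) * (\<Sum>\<sigma> | length \<sigma> = T. \<Sum>v\<in>W.
        exp (\<Sum>i<T. bool_sign (\<sigma> ! i) * cover_exponent q M l' v (take i \<sigma>)))"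
      unfolding B_def that by (rule sum_distrib_left[symmetric])
    also have "\<dots> = exp (2 * l * \<alpha>) * (\<Sum>v\<in>W. \<Sum>\<sigma> | length \<sigma> = T.
        exp (\<Sum>i<T. bool_sign (\<sigma> ! i) * cover_exponent q M l' v (take i \<sigma>)))"
      by (subst sum.swap) (rule refl)
    also have "\<dots> \<le> exp (2 * l * \<alpha>) * (\<Sum>v\<in>W. 2 ^ T * E)"
      by (intro mult_left_mono sum_mono mgf) auto
    also have "\<dots> = 2 ^ T * (exp (2 * l * \<alpha>) * E * card W)"
      by simp
    finally show ?thesis .
  qed
  have "exp (l * (SUP f\<in>F. \<Sum>i<T. q (Suc i) * (bool_sign (\<sigma> ! i) * (f (z' (take i \<sigma>)) - f (z (take i \<sigma>))))))
      \<le> (B l V' \<sigma> + B (- l) V \<sigma>) / 2" if \<sigma>: "length \<sigma> = T" for \<sigma>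
  proof -
    let ?Y = "\<lambda>f. \<Sum>i<T. q (Suc i) * (bool_sign (\<sigma> ! i) * (f (z' (take i \<sigma>)) - f (z (take i \<sigma>))))"
    have le: "exp (l * ?Y f) \<le> (B l V' \<sigma> + B (- l) V \<sigma>) / 2" if f: "f \<in> F" for f
    proof -
      let ?A = "\<lambda>l z. \<Sum>i<T. bool_sign (\<sigma> ! i) * (2 * l * q (Suc i) * (f (z (take i \<sigma>)) - M / 2))"
      have eq: "l * ?Y f = (?A l z' + ?A (- l) z) / 2"
        unfolding sum.distrib[symmetric] sum_distrib_left sum_divide_distrib
        by (intro sum.cong refl) (simp add: algebra_simps)
      have "exp (l * ?Y f) \<le> (exp (?A l z') + exp (?A (- l) z)) / 2"
        unfolding eq by (rule exp_midpoint_le)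
      also have "\<dots> \<le> (B l V' \<sigma> + B (- l) V \<sigma>) / 2"
        unfolding B_def
        by (intro divide_right_mono add_mono exp_le_cover_sum[OF V' f \<sigma> bound'[OF f] q]
            exp_le_cover_sum[OF V f \<sigma> bound[OF f] q]) simp_all
      finally show ?thesis .
    qed
    have pos: "0 < (B l V' \<sigma> + B (- l) V \<sigma>) / 2"
      using less_le_trans[OF exp_gt_zero le[OF f0]] .
    \<comment> \<open>The bound is the same for all \<open>f\<close>; taking logarithms turns it
      into a bound on the exponents, which passes to their supremum.\<close>
    have "(SUP f\<in>F. ?Y f) \<le> ln ((B l V' \<sigma> + B (- l) V \<sigma>) / 2) / l"
    proof (rule cSUP_least[OF F])
      fix f assume "f \<in> F"
      from le[OF this] have "ln (exp (l * ?Y f)) \<le> ln ((B l V' \<sigma> + B (- l) V \<sigma>) / 2)"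
        using pos by (intro ln_mono exp_gt_zero)
      then show "?Y f \<le> ln ((B l V' \<sigma> + B (- l) V \<sigma>) / 2) / l"
        unfolding ln_exp pos_le_divide_eq[OF l] by (simp only: mult.commute)
    qed
    then have "l * (SUP f\<in>F. ?Y f) \<le> ln ((B l V' \<sigma> + B (- l) V \<sigma>) / 2)"
      unfolding pos_le_divide_eq[OF l] by (simp only: mult.commute)
    then have "exp (l * (SUP f\<in>F. ?Y f)) \<le> exp (ln ((B l V' \<sigma> + B (- l) V \<sigma>) / 2))"
      by (simp only: exp_le_cancel_iff)
    then show ?thesis
      unfolding exp_ln[OF pos] .
  qed
  then have "(\<Sum>\<sigma> | length \<sigma> = T. exp (l * (SUP f\<in>F.
      \<Sum>i<T. q (Suc i) * (bool_sign (\<sigma> ! i) * (f (z' (take i \<sigma>)) - f (z (take i \<sigma>)))))))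
    \<le> (\<Sum>\<sigma> | length \<sigma> = T. (B l V' \<sigma> + B (- l) V \<sigma>) / 2)"
    by (intro sum_mono) (simp only: mem_Collect_eq)
  also have "\<dots> = ((\<Sum>\<sigma> | length \<sigma> = T. B l V' \<sigma>) + (\<Sum>\<sigma> | length \<sigma> = T. B (- l) V \<sigma>)) / 2"
    by (simp add: sum.distrib add_divide_distrib flip: sum_divide_distrib)
  also have "\<dots> \<le> (2 ^ T * (exp (2 * l * \<alpha>) * E * card V') + 2 ^ T * (exp (2 * l * \<alpha>) * E * card V)) / 2"
    using l by (intro divide_right_mono add_mono sumB) simp_all
  also have "\<dots> = 2 ^ T * (exp (2 * l * \<alpha>) * E / 2 * (card V + card V'))"
    by (simp add: algebra_simps)
  finally show ?thesis
    by (simp only: E_def exp_add)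
qed

lemma covering_number_attained:
  assumes "covering_number T q \<alpha> F z \<noteq> \<infinity>"
  obtains V where "finite V" "seq_cover T q \<alpha> F z V" "covering_number T q \<alpha> F z = enat (card V)"
proof -
  let ?C = "{V. finite V \<and> seq_cover T q \<alpha> F z V}"
  have ne: "?C \<noteq> {}"
  proof
    assume "?C = {}"
    then show False
      using assms unfolding covering_number_def by (simp only: image_empty) (simp add: top_enat_def)
  qed
  then have "covering_number T q \<alpha> F z \<in> (\<lambda>V. enat (card V)) ` ?C"
  proof -
    obtain V where "V \<in> ?C" using ne by blast
    then have "enat (card V) \<in> (\<lambda>V. enat (card V)) ` ?C" by blast
    then show ?thesis
      unfolding covering_number_def by (rule wellorder_InfI)
  qed
  then show ?thesis using that by auto
qed

lemma symmetrized_mgf_le_covering_number: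
  assumes F: "F \<noteq> {}"
    and bound: "\<And>f s. f \<in> F \<Longrightarrow> s \<in> nodes T \<Longrightarrow> 0 \<le> f (z s) \<and> f (z s) \<le> M"
    and bound': "\<And>f s. f \<in> F \<Longrightarrow> s \<in> nodes T \<Longrightarrow> 0 \<le> f (z' s) \<and> f (z' s) \<le> M"
    and q: "\<exists>t\<in>{1..T}. q t \<noteq> 0" and l: "0 < l"
  shows "(\<Sum>\<sigma> | length \<sigma> = T. ennreal (exp (l * (SUP f\<in>F.
      \<Sum>i<T. q (Suc i) * (bool_sign (\<sigma> ! i) * (f (z' (take i \<sigma>)) - f (z (take i \<sigma>))))))))
    \<le> ennreal (2 ^ T * (exp (2 * l * \<alpha> + l\<^sup>2 * M\<^sup>2 * (L2_set q {1..T})\<^sup>2 / 2) / 2)) *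
      (ennreal_of_enat (covering_number T q \<alpha> F z) + ennreal_of_enat (covering_number T q \<alpha> F z'))"
proof (cases "covering_number T q \<alpha> F z = \<infinity> \<or> covering_number T q \<alpha> F z' = \<infinity>")
  case True
  then show ?thesis by (auto simp: ennreal_mult_top)
next
  case False
  obtain V where V: "finite V" "seq_cover T q \<alpha> F z V" "covering_number T q \<alpha> F z = enat (card V)"
    using False covering_number_attained[of T q \<alpha> F z] by metis
  obtain V' where V': "finite V'" "seq_cover T q \<alpha> F z' V'" "covering_number T q \<alpha> F z' = enat (card V')"
    using False covering_number_attained[of T q \<alpha> F z'] by metis
  have enn: "ennreal (a * (b * (real m + real n))) = ennreal (a * b) * (of_nat m + of_nat n)"
    if "0 \<le> a" "0 \<le> b" for a b :: real and m n :: nat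
    using that by (simp add: ennreal_of_nat_eq_real_of_nat mult.assoc flip: ennreal_plus ennreal_mult)
  have "(\<Sum>\<sigma> | length \<sigma> = T. exp (l * (SUP f\<in>F.
      \<Sum>i<T. q (Suc i) * (bool_sign (\<sigma> ! i) * (f (z' (take i \<sigma>)) - f (z (take i \<sigma>)))))))
    \<le> 2 ^ T * (exp (2 * l * \<alpha> + l\<^sup>2 * M\<^sup>2 * (L2_set q {1..T})\<^sup>2 / 2) / 2 * (card V + card V'))"
    by (rule symmetrized_mgf_le_cover[OF V(1,2) V'(1,2) F _ _ q l]; rule bound bound'; assumption)
  from ennreal_leI[OF this] show ?thesis
    unfolding V(3) V'(3) ennreal_of_enat_enat of_nat_add
    by (subst (asm) enn) (simp_all add: sum_ennreal)
qed

section \<open>Sign reflection of trees and their covers\<close>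

definition reflect :: "(bool list \<Rightarrow> 'a) \<Rightarrow> bool list \<Rightarrow> 'a" where
  "reflect z s = z (map Not s)"

lemma reflect_reflect [simp]: "reflect (reflect z) = z"
  by (simp add: reflect_def fun_eq_iff comp_def)

text \<open>A cover has to serve every sign path, so flipping all signs only permutes the
  conditions: the reflected elements cover the reflected tree. Since reflection is an involution,
  equality follows.\<close>

lemma covering_number_reflect_le:
  "covering_number T q \<alpha> F (reflect z) \<le> covering_number T q \<alpha> F z"
  unfolding covering_number_def
proof (rule INF_mono)
  fix V assume "V \<in> {V. finite V \<and> seq_cover T q \<alpha> F z V}"
  then have V: "finite V" "seq_cover T q \<alpha> F z V" by auto
  have "seq_cover T q \<alpha> F (reflect z) (reflect ` V)"
    unfolding seq_cover_def
  proof (intro conjI ballI allI impI)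
    show "reflect ` V \<subseteq> extensional (nodes T)"
      using V(2) by (auto simp: seq_cover_def extensional_def reflect_def nodes_def)
    fix g \<sigma> assume "g \<in> F" and \<sigma>: "length (\<sigma>::bool list) = T"
    then have "\<exists>v\<in>V. (\<Sum>t=1..T. \<bar>label v t (map Not \<sigma>) - g (label z t (map Not \<sigma>))\<bar>)
        \<le> inverse (sup_norm T q) * \<alpha>"
      using V(2) by (simp add: seq_cover_def)
    then show "\<exists>v\<in>reflect ` V. (\<Sum>t=1..T. \<bar>label v t \<sigma> - g (label (reflect z) t \<sigma>)\<bar>)
        \<le> inverse (sup_norm T q) * \<alpha>"
      by (auto simp: label_def reflect_def take_map)
  qed
  moreover have "enat (card (reflect ` V)) \<le> enat (card V)"
    using V(1) by (simp add: card_image_le)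
  ultimately show "\<exists>W\<in>{V. finite V \<and> seq_cover T q \<alpha> F (reflect z) V}. enat (card W) \<le> enat (card V)"
    using V(1) by blast
qed

lemma covering_number_reflect:
  "covering_number T q \<alpha> F (reflect z) = covering_number T q \<alpha> F z"
  using covering_number_reflect_le[of T q \<alpha> F z] covering_number_reflect_le[of T q \<alpha> F "reflect z"]
  by simp

section \<open>Paths of the random tree\<close>

lemma nn_integral_bind_prob_algebra:
  assumes "N \<in> space (prob_algebra A)" "k \<in> A \<rightarrow>\<^sub>M prob_algebra B" "f \<in> borel_measurable B"
  shows "(\<integral>\<^sup>+y. f y \<partial>(N \<bind> k)) = (\<integral>\<^sup>+x. \<integral>\<^sup>+y. f y \<partial>k x \<partial>N)"
proof (rule nn_integral_bind)
  have "sets N = sets A" using assms(1) by (simp add: space_prob_algebra)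
  then have "N \<rightarrow>\<^sub>M subprob_algebra B = A \<rightarrow>\<^sub>M subprob_algebra B"
    by (rule measurable_cong_sets) (rule refl)
  then show "k \<in> N \<rightarrow>\<^sub>M subprob_algebra B"
    using measurable_prob_algebraD[OF assms(2)] by simp
qed fact

lemma prob_algebraD:
  assumes "N \<in> space (prob_algebra A)"
  shows "prob_space N" "sets N = sets A" "space N = space A"
  using assms by (auto simp: space_prob_algebra dest: sets_eq_imp_space_eq)

lemma nn_integral_swap_prob_algebra:
  assumes M: "M \<in> space (prob_algebra A)" and N: "N \<in> space (prob_algebra B)"
    and f: "case_prod f \<in> borel_measurable (A \<Otimes>\<^sub>M B)"
  shows "(\<integral>\<^sup>+x. \<integral>\<^sup>+y. f x y \<partial>N \<partial>M) = (\<integral>\<^sup>+y. \<integral>\<^sup>+x. f x y \<partial>M \<partial>N)"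
proof -
  interpret M: prob_space M by (rule prob_algebraD[OF M])
  interpret N: prob_space N by (rule prob_algebraD[OF N])
  interpret pair_sigma_finite M N ..
  have "sets (M \<Otimes>\<^sub>M N) = sets (A \<Otimes>\<^sub>M B)"
    by (intro sets_pair_measure_cong prob_algebraD[OF M] prob_algebraD[OF N])
  then have "case_prod f \<in> borel_measurable (M \<Otimes>\<^sub>M N)"
    using f by (simp cong: measurable_cong_sets)
  then show ?thesis
    by (rule Fubini'[symmetric])
qed

lemma nn_integral_const_prob_algebra:
  "N \<in> space (prob_algebra A) \<Longrightarrow> (\<integral>\<^sup>+x. c \<partial>N) = (c::ennreal)"
  by (drule prob_algebraD(1)) (simp add: prob_space.emeasure_space_1)

abbreviation histories :: "'z measure \<Rightarrow> nat \<Rightarrow> (nat \<Rightarrow> 'z) measure" where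
  "histories S t \<equiv> \<Pi>\<^sub>M s\<in>{1..<t}. S"

abbreviation pair_trees :: "'z measure \<Rightarrow> nat \<Rightarrow> (bool list \<Rightarrow> 'z \<times> 'z) measure" where
  "pair_trees S n \<equiv> \<Pi>\<^sub>M s\<in>nodes n. S \<Otimes>\<^sub>M S"

lemma measurable_update_history:
  assumes "a \<in> R \<rightarrow>\<^sub>M histories S t" "b \<in> R \<rightarrow>\<^sub>M S" "1 \<le> t"
  shows "(\<lambda>x. (a x)(t := b x)) \<in> R \<rightarrow>\<^sub>M histories S (Suc t)"
  using measurable_compose[OF measurable_Pair[OF assms(1,2)] update_measurable[OF assms(3)]] by simp

lemma update_history_in_space:
  assumes "h \<in> space (histories S t)" "z \<in> space S" "1 \<le> t"
  shows "h(t := z) \<in> space (histories S (Suc t))"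
  using assms by (auto simp: space_PiM PiE_iff extensional_def)

lemma measurable_graft:
  assumes "a \<in> R \<rightarrow>\<^sub>M N" "l \<in> R \<rightarrow>\<^sub>M (\<Pi>\<^sub>M s\<in>nodes n. N)" "r \<in> R \<rightarrow>\<^sub>M (\<Pi>\<^sub>M s\<in>nodes n. N)"
  shows "(\<lambda>x. graft n (a x) (l x) (r x)) \<in> R \<rightarrow>\<^sub>M (\<Pi>\<^sub>M s\<in>nodes (Suc n). N)"
  using measurable_compose[OF measurable_Pair[OF assms(1) measurable_Pair[OF assms(2,3)]] graft_measurable]
  by simp

text \<open>
  Integrates \<open>g\<close> over \<open>n\<close> further steps of the process and its tangent sequence, drawn in the order
  \<open>Z\<^sub>t, Z'\<^sub>t, Z\<^sub>t\<^sub>+\<^sub>1, Z'\<^sub>t\<^sub>+\<^sub>1, \<dots>\<close>. The kernels only see the first history.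
\<close>

primrec path_integral ::
    "(nat \<Rightarrow> (nat \<Rightarrow> 'z) \<Rightarrow> 'z measure) \<Rightarrow> ((nat \<Rightarrow> 'z) \<times> (nat \<Rightarrow> 'z) \<Rightarrow> ennreal) \<Rightarrow>
      nat \<Rightarrow> nat \<Rightarrow> (nat \<Rightarrow> 'z) \<times> (nat \<Rightarrow> 'z) \<Rightarrow> ennreal" where
  "path_integral p g 0 t x = g x"
| "path_integral p g (Suc n) t x =
    (\<integral>\<^sup>+z. \<integral>\<^sup>+z'. path_integral p g n (Suc t) ((fst x)(t := z), (snd x)(t := z')) \<partial>p t (fst x) \<partial>p t (fst x))"

text \<open>
  The pair of histories found along \<open>\<sigma>\<close>: the first one collects the selected components, the second
  one the components not selected.
\<close>

primrec walk ::
    "bool list \<Rightarrow> nat \<Rightarrow> (bool list \<Rightarrow> 'z \<times> 'z) \<Rightarrow> (nat \<Rightarrow> 'z) \<times> (nat \<Rightarrow> 'z) \<Rightarrow>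
      (nat \<Rightarrow> 'z) \<times> (nat \<Rightarrow> 'z)" where
  "walk [] t w x = x"
| "walk (b # \<sigma>) t w x = walk \<sigma> (Suc t) (\<lambda>s. w (b # s))
    ((fst x)(t := if b then fst (w []) else snd (w [])), (snd x)(t := if b then snd (w []) else fst (w [])))"

lemma walk_before:
  "s < t \<Longrightarrow> fst (walk \<sigma> t w x) s = fst x s"
  "s < t \<Longrightarrow> snd (walk \<sigma> t w x) s = snd x s"
  by (induction \<sigma> arbitrary: t w x) auto

text \<open>The origin of the random signs: at node \<open>take i \<sigma>\<close>, second minus
  first history equals second minus first component of the label, up to the factor
  \<open>bool_sign (\<sigma> ! i)\<close>.\<close>

lemma walk_nth:
  "i < length \<sigma> \<Longrightarrow> fst (walk \<sigma> t w x) (t + i) = (if \<sigma> ! i then fst else snd) (w (take i \<sigma>))"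
  "i < length \<sigma> \<Longrightarrow> snd (walk \<sigma> t w x) (t + i) = (if \<sigma> ! i then snd else fst) (w (take i \<sigma>))"
proof (induction \<sigma> arbitrary: t w x i)
  case (Cons b \<sigma>)
  {
    case 1
    then show ?case
      using Cons.IH(1)[of _ "Suc t"] by (cases i) (simp_all add: walk_before)
  next
    case 2
    then show ?case
      using Cons.IH(2)[of _ "Suc t"] by (cases i) (simp_all add: walk_before)
  }
qed auto

lemma measurable_subtree:
  "(\<lambda>w s. w (b # s)) \<in> (\<Pi>\<^sub>M s\<in>nodes (Suc n). N) \<rightarrow>\<^sub>M (\<Pi>\<^sub>M s\<in>nodes n. N)"
proof -
  have "(\<lambda>w. \<lambda>s\<in>nodes n. w (b # s)) \<in> (\<Pi>\<^sub>M s\<in>nodes (Suc n). N) \<rightarrow>\<^sub>M (\<Pi>\<^sub>M s\<in>nodes n. N)"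
    by (intro measurable_restrict measurable_component_singleton) (auto simp: nodes_def)
  \<comment> \<open>Trees in the space are \<open>undefined\<close> off
    \<open>nodes (Suc n)\<close>, so restricting the shifted tree to \<open>nodes n\<close> changes
    nothing.\<close>
  then show ?thesis
    by (rule measurable_cong[THEN iffD1, rotated])
       (auto simp: space_PiM PiE_iff extensional_def nodes_def fun_eq_iff)
qed

lemma measurable_walk:
  assumes "1 \<le> t"
  shows "(\<lambda>y. walk \<sigma> t (fst y) (snd y)) \<in>
    pair_trees S (length \<sigma>) \<Otimes>\<^sub>M (histories S t \<Otimes>\<^sub>M histories S t) \<rightarrow>\<^sub>M
    histories S (t + length \<sigma>) \<Otimes>\<^sub>M histories S (t + length \<sigma>)"
  using assms
proof (induction \<sigma> arbitrary: t)
  case Nil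
  then show ?case by simp
next
  case (Cons b \<sigma>)
  let ?R = "pair_trees S (Suc (length \<sigma>)) \<Otimes>\<^sub>M (histories S t \<Otimes>\<^sub>M histories S t)"
  have root: "(\<lambda>w. w []) \<in> pair_trees S (Suc (length \<sigma>)) \<rightarrow>\<^sub>M S \<Otimes>\<^sub>M S"
    by (rule measurable_component_singleton) (simp add: nodes_def)
  have r1: "(\<lambda>y. fst (fst y [])) \<in> ?R \<rightarrow>\<^sub>M S" "(\<lambda>y. snd (fst y [])) \<in> ?R \<rightarrow>\<^sub>M S"
    using measurable_compose[OF measurable_compose[OF measurable_fst root] measurable_fst]
      measurable_compose[OF measurable_compose[OF measurable_fst root] measurable_snd] by auto
  have u: "(\<lambda>y. ((fst (snd y))(t := if b then fst (fst y []) else snd (fst y [])),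
      (snd (snd y))(t := if b then snd (fst y []) else fst (fst y [])))) \<in>
      ?R \<rightarrow>\<^sub>M histories S (Suc t) \<Otimes>\<^sub>M histories S (Suc t)"
    using Cons.prems r1 by (intro measurable_Pair measurable_update_history) (cases b; simp)+
  have s: "(\<lambda>y s. fst y (b # s)) \<in> ?R \<rightarrow>\<^sub>M pair_trees S (length \<sigma>)"
    by (rule measurable_compose[OF measurable_fst measurable_subtree])
  have "1 \<le> Suc t" by simp
  from measurable_compose[OF measurable_Pair[OF s u] Cons.IH[OF this]]
  show ?case by simp
qed

text \<open>The \<open>+1\<close> subtree continues the history with the first component. An
  exchange of components therefore respects the law only if the two subtrees are exchanged as well,
  at every node; hence the flipped signs in the argument.\<close>

definition swap_tree :: "nat \<Rightarrow> (bool list \<Rightarrow> 'z \<times> 'z) \<Rightarrow> bool list \<Rightarrow> 'z \<times> 'z" where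
  "swap_tree n w = (\<lambda>s\<in>nodes n. prod.swap (w (map Not s)))"

lemma swap_tree_graft:
  "swap_tree (Suc n) (graft n (z, z') l r) = graft n (z', z) (swap_tree n r) (swap_tree n l)"
  by (auto simp: swap_tree_def graft_def nodes_def fun_eq_iff split: list.split)

lemma measurable_swap_tree: "swap_tree n \<in> pair_trees S n \<rightarrow>\<^sub>M pair_trees S n"
  unfolding swap_tree_def
proof (rule measurable_restrict)
  fix s assume "s \<in> nodes n"
  then have "(\<lambda>w. w (map Not s)) \<in> pair_trees S n \<rightarrow>\<^sub>M S \<Otimes>\<^sub>M S"
    by (intro measurable_component_singleton) (simp add: nodes_def)
  from measurable_compose[OF this measurable_pair_swap']
  show "(\<lambda>w. prod.swap (w (map Not s))) \<in> pair_trees S n \<rightarrow>\<^sub>M S \<Otimes>\<^sub>M S"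
    by (simp add: prod.swap_def case_prod_beta')
qed

lemma subtree_graft:
  assumes "l \<in> extensional (nodes n)" "r \<in> extensional (nodes n)"
  shows "(\<lambda>s. graft n a l r (b # s)) = (if b then l else r)"
  using assms by (auto simp: graft_def nodes_def extensional_def fun_eq_iff)

lemma graft_root: "graft n a l r [] = a"
  by (simp add: graft_def nodes_def)

section \<open>Integration over the law of the random tree\<close>

locale transition_kernels =
  fixes S :: "'z measure" and p :: "nat \<Rightarrow> (nat \<Rightarrow> 'z) \<Rightarrow> 'z measure" and T :: nat
  assumes kernel: "\<And>t. t \<in> {1..T} \<Longrightarrow> p t \<in> histories S t \<rightarrow>\<^sub>M prob_algebra S"
begin

lemma kernel_in_space:
  "1 \<le> t \<Longrightarrow> t \<le> T \<Longrightarrow> h \<in> space (histories S t) \<Longrightarrow> p t h \<in> space (prob_algebra S)"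
  using measurable_space[OF kernel] by simp

lemma pair_tree_law_in_space:
  "1 \<le> t \<Longrightarrow> t + n \<le> T + 1 \<Longrightarrow> h \<in> space (histories S t) \<Longrightarrow>
    pair_tree_law S p n t h \<in> space (prob_algebra (pair_trees S n))"
  by (rule measurable_space[OF measurable_pair_tree_law[OF kernel]])

text \<open>Turns the monadic definition into iterated integrals. Each bind asks for a measurable
  continuation, so \<open>k4\<close> to \<open>k1\<close> are shown jointly measurable in all
  variables bound before them, from the inside out, and then restricted to sections.\<close>

lemma nn_integral_pair_tree_law_Suc:
  assumes t: "1 \<le> t" "t + Suc n \<le> T + 1" and h: "h \<in> space (histories S t)"
    and g: "g \<in> borel_measurable (pair_trees S (Suc n))"
  shows "(\<integral>\<^sup>+w. g w \<partial>pair_tree_law S p (Suc n) t h) =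
    (\<integral>\<^sup>+z. \<integral>\<^sup>+z'. \<integral>\<^sup>+l. \<integral>\<^sup>+r. g (graft n (z, z') l r) \<partial>pair_tree_law S p n (Suc t) (h(t := z'))
      \<partial>pair_tree_law S p n (Suc t) (h(t := z)) \<partial>p t h \<partial>p t h)"
proof -
  let ?N = "pair_trees S n" and ?NN = "pair_trees S (Suc n)" and ?L = "pair_tree_law S p n (Suc t)"
  define k4 where "k4 = (\<lambda>z z' l r. return ?NN (graft n (z, z') l r))"
  define k3 where "k3 = (\<lambda>z z' l. ?L (h(t := z')) \<bind> k4 z z' l)"
  define k2 where "k2 = (\<lambda>z z'. ?L (h(t := z)) \<bind> k3 z z')"
  define k1 where "k1 = (\<lambda>z. p t h \<bind> k2 z)"
  have pt: "p t h \<in> space (prob_algebra S)"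
    using t h by (intro kernel_in_space) auto
  have L: "?L \<in> histories S (Suc t) \<rightarrow>\<^sub>M prob_algebra ?N"
    using t by (intro measurable_pair_tree_law[OF kernel]) auto
  have u: "(\<lambda>x. h(t := b x)) \<in> R \<rightarrow>\<^sub>M histories S (Suc t)" if "b \<in> R \<rightarrow>\<^sub>M S" for b and R :: "'c measure"
    using h t that by (intro measurable_update_history) auto
  have M4: "(\<lambda>x. k4 (fst (fst (fst x))) (snd (fst (fst x))) (snd (fst x)) (snd x))
      \<in> ((S \<Otimes>\<^sub>M S) \<Otimes>\<^sub>M ?N) \<Otimes>\<^sub>M ?N \<rightarrow>\<^sub>M prob_algebra ?NN"
    unfolding k4_def by (intro measurable_compose[OF _ measurable_return_prob_space] measurable_graft) simp_all
  have M3: "(\<lambda>x. k3 (fst (fst x)) (snd (fst x)) (snd x)) \<in> (S \<Otimes>\<^sub>M S) \<Otimes>\<^sub>M ?N \<rightarrow>\<^sub>M prob_algebra ?NN"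
    unfolding k3_def using M4
    by (intro measurable_bind_prob_space2[where N="?N"] measurable_compose[OF _ L] u) (simp_all add: case_prod_beta')
  have M2: "(\<lambda>x. k2 (fst x) (snd x)) \<in> S \<Otimes>\<^sub>M S \<rightarrow>\<^sub>M prob_algebra ?NN"
    unfolding k2_def using M3
    by (intro measurable_bind_prob_space2[where N="?N"] measurable_compose[OF _ L] u) (simp_all add: case_prod_beta')
  have M1: "k1 \<in> S \<rightarrow>\<^sub>M prob_algebra ?NN"
    unfolding k1_def using M2 pt
    by (intro measurable_bind_prob_space2[where N=S]) (simp_all add: case_prod_beta')
  have M2': "k2 z \<in> S \<rightarrow>\<^sub>M prob_algebra ?NN" if "z \<in> space S" for z
    using measurable_compose[OF measurable_Pair1'[OF that] M2] by simp
  have M3': "k3 z z' \<in> ?N \<rightarrow>\<^sub>M prob_algebra ?NN" if "z \<in> space S" "z' \<in> space S" for z z'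
    using measurable_compose[OF measurable_Pair1' M3, of "(z, z')"] that by (simp add: space_pair_measure)
  have M4': "k4 z z' l \<in> ?N \<rightarrow>\<^sub>M prob_algebra ?NN" if "z \<in> space S" "z' \<in> space S" "l \<in> space ?N" for z z' l
    using measurable_compose[OF measurable_Pair1' M4, of "((z, z'), l)"] that by (simp add: space_pair_measure)
  have Lsp: "?L (h(t := z)) \<in> space (prob_algebra ?N)" if "z \<in> space S" for z
    using measurable_space[OF L] update_history_in_space[OF h that] t by simp
  have G: "graft n (z, z') l r \<in> space ?NN"
    if "z \<in> space S" "z' \<in> space S" "l \<in> space ?N" "r \<in> space ?N" for z z' l r
    using measurable_space[OF graft_measurable, of "((z, z'), l, r)" "S \<Otimes>\<^sub>M S" n] that
    by (simp add: space_pair_measure)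
  have "(\<integral>\<^sup>+w. g w \<partial>pair_tree_law S p (Suc n) t h) = (\<integral>\<^sup>+w. g w \<partial>(p t h \<bind> k1))"
    by (simp add: k1_def k2_def k3_def k4_def)
  also have "\<dots> = (\<integral>\<^sup>+z. \<integral>\<^sup>+w. g w \<partial>k1 z \<partial>p t h)"
    by (rule nn_integral_bind_prob_algebra[OF pt M1 g])
  also have "\<dots> = (\<integral>\<^sup>+z. \<integral>\<^sup>+z'. \<integral>\<^sup>+w. g w \<partial>k2 z z' \<partial>p t h \<partial>p t h)"
    unfolding k1_def
    by (intro nn_integral_cong nn_integral_bind_prob_algebra[OF pt M2' g]) (simp add: prob_algebraD[OF pt])
  also have "\<dots> = (\<integral>\<^sup>+z. \<integral>\<^sup>+z'. \<integral>\<^sup>+l. \<integral>\<^sup>+w. g w \<partial>k3 z z' l \<partial>?L (h(t := z)) \<partial>p t h \<partial>p t h)"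
    unfolding k2_def
    by (intro nn_integral_cong nn_integral_bind_prob_algebra[OF Lsp M3' g]) (simp_all add: prob_algebraD[OF pt])
  also have "\<dots> = (\<integral>\<^sup>+z. \<integral>\<^sup>+z'. \<integral>\<^sup>+l. \<integral>\<^sup>+r. \<integral>\<^sup>+w. g w \<partial>k4 z z' l r \<partial>?L (h(t := z')) \<partial>?L (h(t := z)) \<partial>p t h \<partial>p t h)"
    unfolding k3_def
    by (intro nn_integral_cong nn_integral_bind_prob_algebra[OF Lsp M4' g])
       (simp_all add: prob_algebraD[OF pt] prob_algebraD[OF Lsp])
  also have "\<dots> = (\<integral>\<^sup>+z. \<integral>\<^sup>+z'. \<integral>\<^sup>+l. \<integral>\<^sup>+r. g (graft n (z, z') l r) \<partial>?L (h(t := z')) \<partial>?L (h(t := z)) \<partial>p t h \<partial>p t h)"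
    unfolding k4_def
    by (intro nn_integral_cong nn_integral_return g G)
       (simp_all add: prob_algebraD[OF pt] prob_algebraD[OF Lsp])
  finally show ?thesis .
qed

lemma measurable_path_integral:
  assumes g: "g \<in> borel_measurable (histories S (Suc T) \<Otimes>\<^sub>M histories S (Suc T))"
  shows "1 \<le> t \<Longrightarrow> t + n = Suc T \<Longrightarrow>
    path_integral p g n t \<in> borel_measurable (histories S t \<Otimes>\<^sub>M histories S t)"
proof (induction n arbitrary: t)
  case 0
  then show ?case using g by (simp add: fun_eq_iff[symmetric])
next
  case (Suc n)
  let ?R = "histories S t \<Otimes>\<^sub>M histories S t"
  have k: "(\<lambda>x. p t (fst x)) \<in> ?R \<rightarrow>\<^sub>M subprob_algebra S"
    using Suc.prems by (intro measurable_compose[OF measurable_fst measurable_prob_algebraD[OF kernel]]) auto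
  have k': "(\<lambda>x. p t (fst (fst x))) \<in> ?R \<Otimes>\<^sub>M S \<rightarrow>\<^sub>M subprob_algebra S"
    using measurable_compose[OF measurable_fst k] by simp
  have IH: "path_integral p g n (Suc t) \<in> borel_measurable (histories S (Suc t) \<Otimes>\<^sub>M histories S (Suc t))"
    using Suc.prems by (intro Suc.IH) auto
  have "(\<lambda>y. ((fst (fst (fst y)))(t := snd (fst y)), (snd (fst (fst y)))(t := snd y)))
      \<in> (?R \<Otimes>\<^sub>M S) \<Otimes>\<^sub>M S \<rightarrow>\<^sub>M histories S (Suc t) \<Otimes>\<^sub>M histories S (Suc t)"
    using Suc.prems by (intro measurable_Pair measurable_update_history) simp_all
  from measurable_compose[OF this IH]
  have "(\<lambda>x. \<integral>\<^sup>+z'. path_integral p g n (Suc t) ((fst (fst x))(t := snd x), (snd (fst x))(t := z')) \<partial>p t (fst (fst x)))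
      \<in> borel_measurable (?R \<Otimes>\<^sub>M S)"
    by (intro nn_integral_measurable_subprob_algebra2[OF _ k']) (simp add: case_prod_beta')
  then have "(\<lambda>x. \<integral>\<^sup>+z. \<integral>\<^sup>+z'. path_integral p g n (Suc t) ((fst x)(t := z), (snd x)(t := z')) \<partial>p t (fst x) \<partial>p t (fst x))
      \<in> borel_measurable ?R"
    by (intro nn_integral_measurable_subprob_algebra2[OF _ k]) (simp add: case_prod_beta')
  then show ?case by simp
qed

text \<open>The right side depends on \<open>\<sigma>\<close> only through its length. At each root
  the two components are independent draws from one kernel, so by Fubini they may be exchanged on a
  minus sign; the subtree entered is the one grown from the selected component, and the law of the
  other subtree has mass one.\<close>

lemma nn_integral_walk:
  assumes g: "g \<in> borel_measurable (histories S (Suc T) \<Otimes>\<^sub>M histories S (Suc T))"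
  shows "1 \<le> t \<Longrightarrow> t + length \<sigma> = Suc T \<Longrightarrow> x \<in> space (histories S t \<Otimes>\<^sub>M histories S t) \<Longrightarrow>
    (\<integral>\<^sup>+w. g (walk \<sigma> t w x) \<partial>pair_tree_law S p (length \<sigma>) t (fst x)) = path_integral p g (length \<sigma>) t x"
proof (induction \<sigma> arbitrary: t x)
  case Nil
  have "(\<integral>\<^sup>+w. g x \<partial>pair_tree_law S p 0 t (fst x)) = g x"
    unfolding pair_tree_law.simps by (rule nn_integral_return) (simp_all add: space_PiM nodes_def)
  then show ?case by simp
next
  case (Cons b \<sigma>)
  let ?n = "length \<sigma>" and ?h = "fst x" and ?h' = "snd x"
  let ?L = "pair_tree_law S p ?n (Suc t)" and ?N = "pair_trees S ?n"
  let ?J = "path_integral p g ?n (Suc t)"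
  have t: "1 \<le> t" "t + Suc ?n \<le> T + 1" "Suc t + ?n = Suc T" "t \<le> T" "1 \<le> Suc t" using Cons.prems by auto
  have h: "?h \<in> space (histories S t)" "?h' \<in> space (histories S t)"
    using Cons.prems by (auto simp: space_pair_measure)
  have pt: "p t ?h \<in> space (prob_algebra S)" by (rule kernel_in_space[OF t(1,4) h(1)])
  have Lsp: "?L (?h(t := z)) \<in> space (prob_algebra ?N)" if "z \<in> space S" for z
    using t update_history_in_space[OF h(1) that] by (intro pair_tree_law_in_space) auto
  have gw: "(\<lambda>w. g (walk \<tau> s w y)) \<in> borel_measurable (pair_trees S (length \<tau>))"
    if "1 \<le> s" "s + length \<tau> = Suc T" "y \<in> space (histories S s \<Otimes>\<^sub>M histories S s)" for \<tau> s y
    using measurable_compose[OF measurable_Pair[OF measurable_ident_sets[OF refl] measurable_const[OF that(3)]]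
        measurable_compose[OF measurable_walk[OF that(1)] g[folded that(2)]]]
    by simp
  have ext: "l \<in> extensional (nodes ?n)" if "l \<in> space ?N" for l
    using that by (simp add: space_PiM PiE_iff)
  have IH: "(\<integral>\<^sup>+w. g (walk \<sigma> (Suc t) w (?h(t := z), ?h'(t := z'))) \<partial>?L (?h(t := z))) =
      ?J (?h(t := z), ?h'(t := z'))" if "z \<in> space S" "z' \<in> space S" for z z'
  proof -
    have "(?h(t := z), ?h'(t := z')) \<in> space (histories S (Suc t) \<Otimes>\<^sub>M histories S (Suc t))"
      unfolding space_pair_measure by (intro SigmaI update_history_in_space h that t(1))
    from Cons.IH[OF t(5,3) this] show ?thesis by (simp only: fst_conv)
  qed
  have Jm: "(\<lambda>(z, z'). ?J (?h(t := z), ?h'(t := z'))) \<in> borel_measurable (S \<Otimes>\<^sub>M S)"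
  proof -
    have "(\<lambda>y. (?h(t := fst y), ?h'(t := snd y))) \<in> S \<Otimes>\<^sub>M S \<rightarrow>\<^sub>M histories S (Suc t) \<Otimes>\<^sub>M histories S (Suc t)"
      using t h by (intro measurable_Pair measurable_update_history) simp_all
    from measurable_compose[OF this measurable_path_integral[OF g t(5,3)]]
    show ?thesis by (simp add: case_prod_beta')
  qed
  have "(\<integral>\<^sup>+w. g (walk (b # \<sigma>) t w x) \<partial>pair_tree_law S p (length (b # \<sigma>)) t (fst x)) =
    (\<integral>\<^sup>+z. \<integral>\<^sup>+z'. \<integral>\<^sup>+l. \<integral>\<^sup>+r. g (walk (b # \<sigma>) t (graft ?n (z, z') l r) x)
      \<partial>?L (?h(t := z')) \<partial>?L (?h(t := z)) \<partial>p t ?h \<partial>p t ?h)"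
    using nn_integral_pair_tree_law_Suc[OF t(1,2) h(1), of "\<lambda>w. g (walk (b # \<sigma>) t w x)"]
      gw[OF t(1), of "b # \<sigma>" x] Cons.prems by simp
  also have "\<dots> = (\<integral>\<^sup>+z. \<integral>\<^sup>+z'. \<integral>\<^sup>+l. \<integral>\<^sup>+r. g (walk \<sigma> (Suc t) (if b then l else r)
       (?h(t := if b then z else z'), ?h'(t := if b then z' else z)))
      \<partial>?L (?h(t := z')) \<partial>?L (?h(t := z)) \<partial>p t ?h \<partial>p t ?h)"
    by (intro nn_integral_cong)
       (simp add: prob_algebraD[OF pt] prob_algebraD[OF Lsp] ext subtree_graft graft_root)
  also have "\<dots> = (\<integral>\<^sup>+z. \<integral>\<^sup>+z'. ?J (?h(t := if b then z else z'), ?h'(t := if b then z' else z)) \<partial>p t ?h \<partial>p t ?h)"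
  proof (intro nn_integral_cong)
    fix z z' assume "z \<in> space (p t ?h)" "z' \<in> space (p t ?h)"
    then have z: "z \<in> space S" "z' \<in> space S" by (simp_all add: prob_algebraD[OF pt])
    show "(\<integral>\<^sup>+l. \<integral>\<^sup>+r. g (walk \<sigma> (Suc t) (if b then l else r)
       (?h(t := if b then z else z'), ?h'(t := if b then z' else z)))
      \<partial>?L (?h(t := z')) \<partial>?L (?h(t := z))) = ?J (?h(t := if b then z else z'), ?h'(t := if b then z' else z))"
      using z by (cases b) (simp_all add: IH nn_integral_const_prob_algebra[OF Lsp] del: nn_integral_const)
  qed
  also have "\<dots> = (\<integral>\<^sup>+z. \<integral>\<^sup>+z'. ?J (?h(t := z), ?h'(t := z')) \<partial>p t ?h \<partial>p t ?h)"
    using nn_integral_swap_prob_algebra[OF pt pt Jm] by (cases b) simp_all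
  finally show ?case by simp
qed

text \<open>The root pair is exchangeable, and given it the subtrees are independent and, by
  induction, themselves invariant. What is left of the swap is an exchange of \<open>z\<close> with
  \<open>z'\<close> and of \<open>l\<close> with \<open>r\<close>, and Fubini undoes both.\<close>

lemma nn_integral_swap_tree:
  "1 \<le> t \<Longrightarrow> t + n \<le> T + 1 \<Longrightarrow> h \<in> space (histories S t) \<Longrightarrow>
    g \<in> borel_measurable (pair_trees S n) \<Longrightarrow>
    (\<integral>\<^sup>+w. g (swap_tree n w) \<partial>pair_tree_law S p n t h) = (\<integral>\<^sup>+w. g w \<partial>pair_tree_law S p n t h)"
proof (induction n arbitrary: t h g)
  case 0
  have "swap_tree 0 = (\<lambda>_. \<lambda>_. undefined :: 'z \<times> 'z)"
    by (simp add: swap_tree_def nodes_def fun_eq_iff)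
  moreover have "(\<lambda>_. undefined) \<in> space (pair_trees S 0)"
    by (simp add: space_PiM nodes_def)
  ultimately show ?case
    using nn_integral_return[OF _ 0(4)] nn_integral_return[of "\<lambda>_. undefined" "pair_trees S 0" "\<lambda>_. g (\<lambda>_. undefined)"]
    by (simp del: nn_integral_const)
next
  case (Suc n)
  let ?L = "pair_tree_law S p n (Suc t)" and ?N = "pair_trees S n"
  have t: "1 \<le> t" "t + Suc n \<le> T + 1" "1 \<le> Suc t" "Suc t + n \<le> T + 1" "t \<le> T" using Suc.prems by auto
  note h = Suc.prems(3) and g = Suc.prems(4)
  have pt: "p t h \<in> space (prob_algebra S)" by (rule kernel_in_space[OF t(1,5) h])
  have L: "?L \<in> histories S (Suc t) \<rightarrow>\<^sub>M prob_algebra ?N"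
    using t by (intro measurable_pair_tree_law[OF kernel]) auto
  have u: "(\<lambda>x. h(t := b x)) \<in> R \<rightarrow>\<^sub>M histories S (Suc t)" if "b \<in> R \<rightarrow>\<^sub>M S" for b and R :: "'c measure"
    using h t that by (intro measurable_update_history) auto
  have up: "h(t := z) \<in> space (histories S (Suc t))" if "z \<in> space S" for z
    by (rule update_history_in_space[OF h that t(1)])
  have Lsp: "?L (h(t := z)) \<in> space (prob_algebra ?N)" if "z \<in> space S" for z
    by (rule pair_tree_law_in_space[OF t(3,4) up[OF that]])
  have gg: "(\<lambda>x. g (graft n (a x) (l x) (r x))) \<in> borel_measurable R"
    if "a \<in> R \<rightarrow>\<^sub>M S \<Otimes>\<^sub>M S" "l \<in> R \<rightarrow>\<^sub>M ?N" "r \<in> R \<rightarrow>\<^sub>M ?N" for a l r and R :: "'c measure"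
    by (rule measurable_compose[OF measurable_graft[OF that] g])
  \<comment> \<open>The inner integral once induction has removed the swaps inside the subtrees:
    only the names of the root components and of the subtrees are still exchanged.\<close>
  define G where "G = (\<lambda>z z'. \<integral>\<^sup>+l. \<integral>\<^sup>+r. g (graft n (z', z) r l) \<partial>?L (h(t := z')) \<partial>?L (h(t := z)))"
  have G: "case_prod G \<in> borel_measurable (S \<Otimes>\<^sub>M S)"
  proof -
    have "(\<lambda>x. g (graft n (snd (fst (fst x)), fst (fst (fst x))) (snd x) (snd (fst x))))
        \<in> borel_measurable (((S \<Otimes>\<^sub>M S) \<Otimes>\<^sub>M ?N) \<Otimes>\<^sub>M ?N)"
      by (intro gg measurable_Pair) simp_all
    then have "(\<lambda>x. \<integral>\<^sup>+r. g (graft n (snd (fst x), fst (fst x)) r (snd x)) \<partial>?L (h(t := snd (fst x))))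
        \<in> borel_measurable ((S \<Otimes>\<^sub>M S) \<Otimes>\<^sub>M ?N)"
      by (intro nn_integral_measurable_subprob_algebra2[where N="?N"] measurable_prob_algebraD
          measurable_compose[OF _ L] u) (simp_all add: case_prod_beta')
    then show ?thesis
      unfolding G_def case_prod_beta'
      by (intro nn_integral_measurable_subprob_algebra2[where N="?N"] measurable_prob_algebraD
          measurable_compose[OF _ L] u) (simp_all add: case_prod_beta')
  qed
  have "(\<integral>\<^sup>+w. g (swap_tree (Suc n) w) \<partial>pair_tree_law S p (Suc n) t h) =
    (\<integral>\<^sup>+z. \<integral>\<^sup>+z'. \<integral>\<^sup>+l. \<integral>\<^sup>+r. g (graft n (z', z) (swap_tree n r) (swap_tree n l))
      \<partial>?L (h(t := z')) \<partial>?L (h(t := z)) \<partial>p t h \<partial>p t h)"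
    using nn_integral_pair_tree_law_Suc[OF t(1,2) h measurable_compose[OF measurable_swap_tree g]]
    by (simp only: swap_tree_graft)
  also have "\<dots> = (\<integral>\<^sup>+z. \<integral>\<^sup>+z'. G z z' \<partial>p t h \<partial>p t h)"
  proof (rule nn_integral_cong, rule nn_integral_cong)
    fix z z' assume "z \<in> space (p t h)" "z' \<in> space (p t h)"
    then have z: "z \<in> space S" "z' \<in> space S" by (simp_all add: prob_algebraD[OF pt])
    have zz: "(\<lambda>_. (z', z)) \<in> R \<rightarrow>\<^sub>M S \<Otimes>\<^sub>M S" for R :: "'c measure"
      using z by (simp add: space_pair_measure)
    have "(\<integral>\<^sup>+l. \<integral>\<^sup>+r. g (graft n (z', z) (swap_tree n r) (swap_tree n l))
        \<partial>?L (h(t := z')) \<partial>?L (h(t := z))) =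
      (\<integral>\<^sup>+l. \<integral>\<^sup>+r. g (graft n (z', z) r (swap_tree n l)) \<partial>?L (h(t := z')) \<partial>?L (h(t := z)))"
    proof (rule nn_integral_cong)
      fix l assume "l \<in> space (?L (h(t := z)))"
      then have "swap_tree n l \<in> space ?N"
        using measurable_space[OF measurable_swap_tree] by (simp add: prob_algebraD[OF Lsp[OF z(1)]])
      then show "(\<integral>\<^sup>+r. g (graft n (z', z) (swap_tree n r) (swap_tree n l)) \<partial>?L (h(t := z'))) =
          (\<integral>\<^sup>+r. g (graft n (z', z) r (swap_tree n l)) \<partial>?L (h(t := z')))"
        by (intro Suc.IH[OF t(3,4) up[OF z(2)], of "\<lambda>r. g (graft n (z', z) r (swap_tree n l))"] gg zz) simp_all
    qed
    also have "\<dots> = G z z'"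
      unfolding G_def
      by (intro Suc.IH[OF t(3,4) up[OF z(1)], of "\<lambda>l. \<integral>\<^sup>+r. g (graft n (z', z) r l) \<partial>?L (h(t := z'))"]
          nn_integral_measurable_subprob_algebra2[where N="?N"] measurable_const)
         (use Lsp[OF z(2)] in \<open>auto simp: case_prod_beta' space_prob_algebra space_subprob_algebra
            prob_space_imp_subprob_space intro!: gg zz\<close>)
    finally show "(\<integral>\<^sup>+l. \<integral>\<^sup>+r. g (graft n (z', z) (swap_tree n r) (swap_tree n l))
        \<partial>?L (h(t := z')) \<partial>?L (h(t := z))) = G z z'" .
  qed
  also have "\<dots> = (\<integral>\<^sup>+z'. \<integral>\<^sup>+z. G z z' \<partial>p t h \<partial>p t h)"
    by (rule nn_integral_swap_prob_algebra[OF pt pt G])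
  also have "\<dots> = (\<integral>\<^sup>+z'. \<integral>\<^sup>+z. \<integral>\<^sup>+r. \<integral>\<^sup>+l. g (graft n (z', z) r l) \<partial>?L (h(t := z)) \<partial>?L (h(t := z')) \<partial>p t h \<partial>p t h)"
    unfolding G_def
  proof (rule nn_integral_cong, rule nn_integral_cong)
    fix z z' assume "z \<in> space (p t h)" "z' \<in> space (p t h)"
    then have z: "z \<in> space S" "z' \<in> space S" by (simp_all add: prob_algebraD[OF pt])
    have zz: "(\<lambda>_. (z', z)) \<in> R \<rightarrow>\<^sub>M S \<Otimes>\<^sub>M S" for R :: "'c measure"
      using z by (simp add: space_pair_measure)
    show "(\<integral>\<^sup>+l. \<integral>\<^sup>+r. g (graft n (z', z) r l) \<partial>?L (h(t := z')) \<partial>?L (h(t := z))) =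
      (\<integral>\<^sup>+r. \<integral>\<^sup>+l. g (graft n (z', z) r l) \<partial>?L (h(t := z)) \<partial>?L (h(t := z')))"
      by (rule nn_integral_swap_prob_algebra[OF Lsp[OF z(1)] Lsp[OF z(2)],
            where f = "\<lambda>l r. g (graft n (z', z) r l)"])
         (auto simp: case_prod_beta' intro!: gg zz)
  qed
  also have "\<dots> = (\<integral>\<^sup>+w. g w \<partial>pair_tree_law S p (Suc n) t h)"
    by (rule nn_integral_pair_tree_law_Suc[OF t(1,2) h g, symmetric])
  finally show ?case .
qed

end

section \<open>The tangent sequence\<close>

text \<open>Jensen's inequality, by integrating the tangent line of the exponential at the mean;
  boundedness makes both sides integrable.\<close>

lemma expectation_exp_ge:
  assumes "prob_space N" "f \<in> borel_measurable N" "\<And>z. z \<in> space N \<Longrightarrow> \<bar>f z\<bar> \<le> B"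
  shows "ennreal (exp (a * ((\<integral>z. f z \<partial>N) - c))) \<le> (\<integral>\<^sup>+z. ennreal (exp (a * (f z - c))) \<partial>N)"
proof -
  interpret prob_space N by fact
  let ?m = "a * ((\<integral>z. f z \<partial>N) - c)"
  have f: "integrable N f"
    using assms(2,3) by (intro integrable_const_bound[of _ B]) auto
  have "exp (a * (f z - c)) \<le> exp (\<bar>a\<bar> * (B + \<bar>c\<bar>))" if "z \<in> space N" for z
  proof -
    have "\<bar>a * (f z - c)\<bar> \<le> \<bar>a\<bar> * (B + \<bar>c\<bar>)"
      unfolding abs_mult using assms(3)[OF that] by (intro mult_left_mono) auto
    then show ?thesis by simp
  qed
  then have e: "integrable N (\<lambda>z. exp (a * (f z - c)))"
    using assms(2) by (intro integrable_const_bound[of _ "exp (\<bar>a\<bar> * (B + \<bar>c\<bar>))"]) auto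
  have "exp ?m = (\<integral>z. exp ?m * (1 + (a * (f z - c) - ?m)) \<partial>N)"
    using f by (simp add: prob_space)
  also have "\<dots> \<le> (\<integral>z. exp (a * (f z - c)) \<partial>N)"
  proof (rule integral_mono)
    fix z
    have "exp ?m * (1 + (a * (f z - c) - ?m)) \<le> exp ?m * exp (a * (f z - c) - ?m)"
      by (intro mult_left_mono exp_ge_add_one_self) auto
    then show "exp ?m * (1 + (a * (f z - c) - ?m)) \<le> exp (a * (f z - c))"
      by (simp flip: exp_add)
  qed (use f e in auto)
  finally show ?thesis
    using e by (subst nn_integral_eq_integral) (auto intro: ennreal_leI)
qed

text \<open>
  The law of \<open>Z'\<^sub>1, \<dots>, Z'\<^sub>n\<close> given the history \<open>h\<close> of \<open>Z\<close>: a product measure, in contrast to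
  \<^const>\<open>path_integral\<close> with all of \<open>h\<close> known in advance.
\<close>

primrec tangent_law ::
    "'z measure \<Rightarrow> (nat \<Rightarrow> (nat \<Rightarrow> 'z) \<Rightarrow> 'z measure) \<Rightarrow> nat \<Rightarrow> (nat \<Rightarrow> 'z) \<Rightarrow> (nat \<Rightarrow> 'z) measure" where
  "tangent_law S p 0 h = return (histories S 1) (\<lambda>_. undefined)"
| "tangent_law S p (Suc n) h =
    tangent_law S p n (restrict h {1..<Suc n}) \<bind> (\<lambda>h'. p (Suc n) (restrict h {1..<Suc n}) \<bind>
      (\<lambda>z'. return (histories S (Suc (Suc n))) (h'(Suc n := z'))))"

context transition_kernels
begin

lemma measurable_restrict_history:
  "m \<le> n \<Longrightarrow> (\<lambda>h. restrict h {1..<m}) \<in> histories S n \<rightarrow>\<^sub>M histories S m"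
  by (rule measurable_restrict_subset) auto

lemma measurable_tangent_law:
  "n \<le> T \<Longrightarrow> tangent_law S p n \<in> histories S (Suc n) \<rightarrow>\<^sub>M prob_algebra (histories S (Suc n))"
proof (induction n)
  case 0
  have "return (histories S 1) (\<lambda>_. undefined) \<in> space (prob_algebra (histories S 1))"
    by (intro measurable_space[OF measurable_return_prob_space]) (simp add: space_PiM)
  then show ?case by (simp add: fun_eq_iff[symmetric])
next
  case (Suc n)
  let ?t = "Suc n"
  have IH: "tangent_law S p n \<in> histories S ?t \<rightarrow>\<^sub>M prob_algebra (histories S ?t)"
    using Suc by auto
  have k: "p ?t \<in> histories S ?t \<rightarrow>\<^sub>M prob_algebra S"
    using Suc.prems by (intro kernel) auto
  have r: "(\<lambda>h. restrict h {1..<?t}) \<in> histories S (Suc ?t) \<rightarrow>\<^sub>M histories S ?t"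
    by (rule measurable_restrict_history) simp
  have "(\<lambda>h. tangent_law S p n (restrict h {1..<?t}) \<bind> (\<lambda>h'. p ?t (restrict h {1..<?t}) \<bind>
      (\<lambda>z'. return (histories S (Suc ?t)) (h'(?t := z')))))
    \<in> histories S (Suc ?t) \<rightarrow>\<^sub>M prob_algebra (histories S (Suc ?t))"
    apply (rule measurable_bind_prob_space2[OF measurable_compose[OF r IH]])
    apply (simp only: case_prod_beta')
    apply (rule measurable_bind_prob_space2[where N=S])
     apply (rule measurable_compose[OF measurable_compose[OF measurable_fst r] k])
    apply (simp only: case_prod_beta')
    apply (rule measurable_compose[OF _ measurable_return_prob_space])
    apply (rule measurable_update_history)
      apply simp_all
    done
  moreover have "tangent_law S p (Suc n) =
    (\<lambda>h. tangent_law S p n (restrict h {1..<?t}) \<bind> (\<lambda>h'. p ?t (restrict h {1..<?t}) \<bind>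
      (\<lambda>z'. return (histories S (Suc ?t)) (h'(?t := z')))))"
    by (rule ext) simp
  ultimately show ?case by (simp only:)
qed

lemma tangent_law_in_space:
  "n \<le> T \<Longrightarrow> h \<in> space (histories S (Suc n)) \<Longrightarrow>
    tangent_law S p n h \<in> space (prob_algebra (histories S (Suc n)))"
  by (rule measurable_space[OF measurable_tangent_law])

lemma nn_integral_tangent_law_Suc:
  assumes n: "Suc n \<le> T" and h: "h \<in> space (histories S (Suc (Suc n)))"
    and g: "g \<in> borel_measurable (histories S (Suc (Suc n)))"
  shows "(\<integral>\<^sup>+h'. g h' \<partial>tangent_law S p (Suc n) h) =
    (\<integral>\<^sup>+h'. \<integral>\<^sup>+z'. g (h'(Suc n := z')) \<partial>p (Suc n) (restrict h {1..<Suc n})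
      \<partial>tangent_law S p n (restrict h {1..<Suc n}))"
proof -
  let ?t = "Suc n" and ?h = "restrict h {1..<Suc n}"
  have h': "?h \<in> space (histories S ?t)"
    by (rule measurable_space[OF measurable_restrict_history h]) simp
  have pt: "p ?t ?h \<in> space (prob_algebra S)"
    using n h' by (intro kernel_in_space) auto
  have TL: "tangent_law S p n ?h \<in> space (prob_algebra (histories S ?t))"
    using n h' by (intro tangent_law_in_space) auto
  have m: "(\<lambda>x. return (histories S (Suc ?t)) ((fst x)(?t := snd x)))
      \<in> histories S ?t \<Otimes>\<^sub>M S \<rightarrow>\<^sub>M prob_algebra (histories S (Suc ?t))"
    by (intro measurable_compose[OF _ measurable_return_prob_space] measurable_update_history) simp_all
  have m': "(\<lambda>h'. p ?t ?h \<bind> (\<lambda>z'. return (histories S (Suc ?t)) (h'(?t := z'))))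
      \<in> histories S ?t \<rightarrow>\<^sub>M prob_algebra (histories S (Suc ?t))"
    using m pt by (intro measurable_bind_prob_space2[where N=S]) (simp_all add: case_prod_beta')
  have "(\<integral>\<^sup>+h'. g h' \<partial>tangent_law S p (Suc n) h) =
    (\<integral>\<^sup>+h'. \<integral>\<^sup>+y. g y \<partial>(p ?t ?h \<bind> (\<lambda>z'. return (histories S (Suc ?t)) (h'(?t := z')))) \<partial>tangent_law S p n ?h)"
    unfolding tangent_law.simps by (rule nn_integral_bind_prob_algebra[OF TL m' g])
  also have "\<dots> = (\<integral>\<^sup>+h'. \<integral>\<^sup>+z'. g (h'(?t := z')) \<partial>p ?t ?h \<partial>tangent_law S p n ?h)"
  proof (rule nn_integral_cong)
    fix h' assume "h' \<in> space (tangent_law S p n ?h)"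
    then have h': "h' \<in> space (histories S ?t)" by (simp only: prob_algebraD[OF TL])
    have "(\<lambda>z'. return (histories S (Suc ?t)) (h'(?t := z'))) \<in> S \<rightarrow>\<^sub>M prob_algebra (histories S (Suc ?t))"
      using measurable_compose[OF measurable_Pair1'[OF h'] m] by simp
    from nn_integral_bind_prob_algebra[OF pt this g]
    have "(\<integral>\<^sup>+y. g y \<partial>(p ?t ?h \<bind> (\<lambda>z'. return (histories S (Suc ?t)) (h'(?t := z'))))) =
      (\<integral>\<^sup>+z'. \<integral>\<^sup>+y. g y \<partial>return (histories S (Suc ?t)) (h'(?t := z')) \<partial>p ?t ?h)" .
    also have "\<dots> = (\<integral>\<^sup>+z'. g (h'(?t := z')) \<partial>p ?t ?h)"
      by (intro nn_integral_cong nn_integral_return g update_history_in_space h')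
         (unfold prob_algebraD(3)[OF pt], simp_all)
    finally show "(\<integral>\<^sup>+y. g y \<partial>(p ?t ?h \<bind> (\<lambda>z'. return (histories S (Suc ?t)) (h'(?t := z'))))) =
      (\<integral>\<^sup>+z'. g (h'(?t := z')) \<partial>p ?t ?h)" .
  qed
  finally show ?thesis .
qed

text \<open>With \<open>h\<close> known the tangent variables are independent, so the integral of
  the product factorizes and Jensen applies to one factor at a time. The numbers \<open>c i\<close>
  will be the values of \<open>f\<close> along the observed process.\<close>

lemma jensen_tangent_law:
  assumes f: "f \<in> borel_measurable S" and bound: "\<And>z. z \<in> space S \<Longrightarrow> \<bar>f z\<bar> \<le> B"
  shows "n \<le> T \<Longrightarrow> h \<in> space (histories S (Suc n)) \<Longrightarrow>
    ennreal (exp (\<Sum>i<n. a i * ((\<integral>z. f z \<partial>p (Suc i) (restrict h {1..<Suc i})) - c i)))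
    \<le> (\<integral>\<^sup>+h'. ennreal (exp (\<Sum>i<n. a i * (f (h' (Suc i)) - c i))) \<partial>tangent_law S p n h)"
proof (induction n arbitrary: h)
  case 0
  then have "(\<integral>\<^sup>+h'. 1 \<partial>tangent_law S p 0 h) = (1::ennreal)"
    by (rule nn_integral_const_prob_algebra[OF tangent_law_in_space])
  then show ?case by simp
next
  case (Suc n)
  let ?t = "Suc n" and ?h = "restrict h {1..<Suc n}"
  let ?E = "\<lambda>h'. ennreal (exp (\<Sum>i<n. a i * (f (h' (Suc i)) - c i)))"
  let ?e = "\<lambda>z'. ennreal (exp (a n * (f z' - c n)))"
  have h': "?h \<in> space (histories S ?t)"
    by (rule measurable_space[OF measurable_restrict_history Suc.prems(2)]) simp
  have pt: "p ?t ?h \<in> space (prob_algebra S)"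
    using Suc.prems h' by (intro kernel_in_space) auto
  have TL: "tangent_law S p n ?h \<in> space (prob_algebra (histories S ?t))"
    using Suc.prems h' by (intro tangent_law_in_space) auto
  have fm: "f \<in> borel_measurable (p ?t ?h)"
    using f prob_algebraD(2)[OF pt] by (simp cong: measurable_cong_sets)
  have comp: "(\<lambda>h'. f (h' (Suc i))) \<in> borel_measurable (histories S m)" if "Suc i < m" for i m
    using that by (intro measurable_compose[OF _ f] measurable_component_singleton) auto
  have em: "(\<lambda>h'. ennreal (exp (\<Sum>i<k. a i * (f (h' (Suc i)) - c i)))) \<in> borel_measurable (histories S (Suc k))" for k
  proof -
    have "(\<lambda>h'. \<Sum>i<k. a i * (f (h' (Suc i)) - c i)) \<in> borel_measurable (histories S (Suc k))"
      by (intro borel_measurable_sum borel_measurable_times borel_measurable_diff borel_measurable_const comp) auto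
    then show ?thesis by measurable
  qed
  from em[of n] have E': "?E \<in> borel_measurable (tangent_law S p n ?h)"
    using prob_algebraD(2)[OF TL] by (simp cong: measurable_cong_sets)
  \<comment> \<open>The kernel at time \<open>Suc i\<close> sees only times up to \<open>i\<close>,
    so truncating the history first at a later time makes no difference.\<close>
  have restr: "restrict ?h {1..<Suc i} = restrict h {1..<Suc i}" if "i < n" for i
    using that by (auto simp: restrict_def fun_eq_iff)
  have "(\<Sum>i<Suc n. a i * ((\<integral>z. f z \<partial>p (Suc i) (restrict h {1..<Suc i})) - c i)) =
    (\<Sum>i<n. a i * ((\<integral>z. f z \<partial>p (Suc i) (restrict ?h {1..<Suc i})) - c i)) +
      a n * ((\<integral>z. f z \<partial>p ?t ?h) - c n)"
    using restr by simp
  then have "ennreal (exp (\<Sum>i<Suc n. a i * ((\<integral>z. f z \<partial>p (Suc i) (restrict h {1..<Suc i})) - c i))) =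
    ennreal (exp (\<Sum>i<n. a i * ((\<integral>z. f z \<partial>p (Suc i) (restrict ?h {1..<Suc i})) - c i))) *
      ennreal (exp (a n * ((\<integral>z. f z \<partial>p ?t ?h) - c n)))"
    by (simp only: exp_add ennreal_mult exp_ge_zero)
  also have "\<dots> \<le> (\<integral>\<^sup>+h'. ?E h' \<partial>tangent_law S p n ?h) * (\<integral>\<^sup>+z'. ?e z' \<partial>p ?t ?h)"
  proof (rule mult_mono)
    show "ennreal (exp (\<Sum>i<n. a i * ((\<integral>z. f z \<partial>p (Suc i) (restrict ?h {1..<Suc i})) - c i)))
      \<le> (\<integral>\<^sup>+h'. ?E h' \<partial>tangent_law S p n ?h)"
      using Suc.prems(1) by (intro Suc.IH h') simp
    show "ennreal (exp (a n * ((\<integral>z. f z \<partial>p ?t ?h) - c n))) \<le> (\<integral>\<^sup>+z'. ?e z' \<partial>p ?t ?h)"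
      by (intro expectation_exp_ge[where B=B] prob_algebraD(1)[OF pt] fm bound)
        (simp only: prob_algebraD(3)[OF pt])
  qed auto
  also have "\<dots> = (\<integral>\<^sup>+h'. ?E h' * (\<integral>\<^sup>+z'. ?e z' \<partial>p ?t ?h) \<partial>tangent_law S p n ?h)"
    by (rule nn_integral_multc[OF E', symmetric])
  also have "\<dots> = (\<integral>\<^sup>+h'. \<integral>\<^sup>+z'. ?E h' * ?e z' \<partial>p ?t ?h \<partial>tangent_law S p n ?h)"
    using fm by (intro nn_integral_cong nn_integral_cmult[symmetric]) auto
  also have "\<dots> = (\<integral>\<^sup>+h'. \<integral>\<^sup>+z'. ennreal (exp (\<Sum>i<Suc n. a i * (f ((h'(?t := z')) (Suc i)) - c i)))
      \<partial>p ?t ?h \<partial>tangent_law S p n ?h)"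
    by (intro nn_integral_cong) (simp add: exp_add ennreal_mult)
  also have "\<dots> = (\<integral>\<^sup>+h'. ennreal (exp (\<Sum>i<Suc n. a i * (f (h' (Suc i)) - c i))) \<partial>tangent_law S p (Suc n) h)"
    by (rule nn_integral_tangent_law_Suc[OF Suc.prems em, symmetric])
  finally show ?case .
qed

end

section \<open>The process, its disintegration and the reordering of the tangent variables\<close>

locale conditional_process = prob_space P
  for P :: "'w measure" and S :: "'z measure" and Z :: "nat \<Rightarrow> 'w \<Rightarrow> 'z"
    and p :: "nat \<Rightarrow> (nat \<Rightarrow> 'z) \<Rightarrow> 'z measure" and T :: nat +
  assumes random_variables: "\<And>t. t \<in> {1..T} \<Longrightarrow> Z t \<in> P \<rightarrow>\<^sub>M S"
    and cond_distributions: "\<And>t. t \<in> {1..T} \<Longrightarrow> cond_distribution P S Z t (p t)"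
begin

sublocale transition_kernels S p T
  by standard (use cond_distributions in \<open>auto simp: cond_distribution_def\<close>)

lemma measurable_past: "t \<le> Suc T \<Longrightarrow> past Z t \<in> P \<rightarrow>\<^sub>M histories S t"
  unfolding past_def by (intro measurable_restrict random_variables) auto

lemma past_Suc: "1 \<le> t \<Longrightarrow> past Z (Suc t) \<omega> = (past Z t \<omega>)(t := Z t \<omega>)"
  by (auto simp: past_def fun_eq_iff)

lemma restrict_past: "m \<le> n \<Longrightarrow> restrict (past Z n \<omega>) {1..<m} = past Z m \<omega>"
  by (auto simp: past_def fun_eq_iff)

text \<open>\<open>cond_distribution\<close> speaks of rectangles only. They form a generator stable
  under intersection, so the joint law of past and present is the law obtained by drawing a fresh
  value from the kernel, and then the integrals of every nonnegative measurable function
  agree.\<close>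

lemma disintegration:
  assumes t: "1 \<le> t" "t \<le> T" and g: "g \<in> borel_measurable (histories S t \<Otimes>\<^sub>M S)"
  shows "(\<integral>\<^sup>+\<omega>. g (past Z t \<omega>, Z t \<omega>) \<partial>P) =
    (\<integral>\<^sup>+\<omega>. \<integral>\<^sup>+z. g (past Z t \<omega>, z) \<partial>p t (past Z t \<omega>) \<partial>P)"
proof -
  let ?H = "histories S t"
  have past: "past Z t \<in> P \<rightarrow>\<^sub>M ?H" using t by (intro measurable_past) auto
  have Zt: "Z t \<in> P \<rightarrow>\<^sub>M S" using t by (intro random_variables) auto
  have pt: "(\<lambda>\<omega>. p t (past Z t \<omega>)) \<in> P \<rightarrow>\<^sub>M prob_algebra S"
    using t by (intro measurable_compose[OF past] kernel) auto
  have pts: "p t (past Z t \<omega>) \<in> space (prob_algebra S)" if "\<omega> \<in> space P" for \<omega>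
    using measurable_space[OF pt that] .
  define k where "k = (\<lambda>\<omega>. p t (past Z t \<omega>) \<bind> (\<lambda>z. return (?H \<Otimes>\<^sub>M S) (past Z t \<omega>, z)))"
  have km: "(\<lambda>x. return (?H \<Otimes>\<^sub>M S) (past Z t (fst x), snd x)) \<in> P \<Otimes>\<^sub>M S \<rightarrow>\<^sub>M prob_algebra (?H \<Otimes>\<^sub>M S)"
    using past by (intro measurable_compose[OF _ measurable_return_prob_space]) simp
  have k: "k \<in> P \<rightarrow>\<^sub>M prob_algebra (?H \<Otimes>\<^sub>M S)"
    unfolding k_def using km by (intro measurable_bind_prob_space2[OF pt]) (simp add: case_prod_beta')
  have P: "P \<in> space (prob_algebra P)" by (simp add: space_prob_algebra prob_space_axioms)
  have int_k: "(\<integral>\<^sup>+y. f y \<partial>k \<omega>) = (\<integral>\<^sup>+z. f (past Z t \<omega>, z) \<partial>p t (past Z t \<omega>))"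
    if \<omega>: "\<omega> \<in> space P" and f: "f \<in> borel_measurable (?H \<Otimes>\<^sub>M S)" for \<omega> f
  proof -
    have "(\<lambda>z. return (?H \<Otimes>\<^sub>M S) (past Z t \<omega>, z)) \<in> S \<rightarrow>\<^sub>M prob_algebra (?H \<Otimes>\<^sub>M S)"
      using measurable_compose[OF measurable_Pair1'[OF \<omega>] km] by simp
    from nn_integral_bind_prob_algebra[OF pts[OF \<omega>] this f]
    have "(\<integral>\<^sup>+y. f y \<partial>k \<omega>) = (\<integral>\<^sup>+z. \<integral>\<^sup>+y. f y \<partial>return (?H \<Otimes>\<^sub>M S) (past Z t \<omega>, z) \<partial>p t (past Z t \<omega>))"
      by (simp add: k_def)
    also have "\<dots> = (\<integral>\<^sup>+z. f (past Z t \<omega>, z) \<partial>p t (past Z t \<omega>))"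
      using measurable_space[OF past \<omega>]
      by (intro nn_integral_cong nn_integral_return f) (simp add: space_pair_measure prob_algebraD[OF pts[OF \<omega>]])
    finally show ?thesis .
  qed
  have mp: "(\<lambda>\<omega>. (past Z t \<omega>, Z t \<omega>)) \<in> P \<rightarrow>\<^sub>M ?H \<Otimes>\<^sub>M S"
    using past Zt by simp
  have "P \<bind> k \<in> space (prob_algebra (?H \<Otimes>\<^sub>M S))"
    using measurable_space[OF measurable_bind_prob_space[OF measurable_ident k] P] by simp
  note Pk = prob_algebraD[OF this]
  have "distr P (?H \<Otimes>\<^sub>M S) (\<lambda>\<omega>. (past Z t \<omega>, Z t \<omega>)) = P \<bind> k"
  proof (rule measure_eqI_generator_eq[OF Int_stable_pair_measure_generator[of ?H S],
        where A = "\<lambda>_. space ?H \<times> space S"])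
    fix X assume "X \<in> {a \<times> b |a b. a \<in> sets ?H \<and> b \<in> sets S}"
    then obtain B A where X: "X = B \<times> A" and BA: "B \<in> sets ?H" "A \<in> sets S" by blast
    have "emeasure (distr P (?H \<Otimes>\<^sub>M S) (\<lambda>\<omega>. (past Z t \<omega>, Z t \<omega>))) X =
      emeasure P {\<omega> \<in> space P. past Z t \<omega> \<in> B \<and> Z t \<omega> \<in> A}"
      using BA mp by (subst emeasure_distr) (auto simp: X intro!: arg_cong[where f="emeasure P"])
    also have "\<dots> = (\<integral>\<^sup>+\<omega>. emeasure (p t (past Z t \<omega>)) A * indicator B (past Z t \<omega>) \<partial>P)"
      using cond_distributions[of t] t BA by (simp add: cond_distribution_def)
    also have "\<dots> = (\<integral>\<^sup>+\<omega>. \<integral>\<^sup>+y. indicator X y \<partial>k \<omega> \<partial>P)"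
    proof (rule nn_integral_cong)
      fix \<omega> assume \<omega>: "\<omega> \<in> space P"
      have "(\<integral>\<^sup>+y. indicator X y \<partial>k \<omega>) = (\<integral>\<^sup>+z. indicator X (past Z t \<omega>, z) \<partial>p t (past Z t \<omega>))"
        using BA by (intro int_k[OF \<omega>] borel_measurable_indicator) (auto simp: X)
      also have "\<dots> = (\<integral>\<^sup>+z. indicator B (past Z t \<omega>) * indicator A z \<partial>p t (past Z t \<omega>))"
        by (simp add: X indicator_times)
      also have "\<dots> = indicator B (past Z t \<omega>) * emeasure (p t (past Z t \<omega>)) A"
        using BA by (subst nn_integral_cmult)
          (simp_all add: borel_measurable_indicator prob_algebraD(2)[OF pts[OF \<omega>]])
      finally show "emeasure (p t (past Z t \<omega>)) A * indicator B (past Z t \<omega>) = (\<integral>\<^sup>+y. indicator X y \<partial>k \<omega>)"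
        by (simp add: mult.commute)
    qed
    also have "\<dots> = (\<integral>\<^sup>+y. indicator X y \<partial>(P \<bind> k))"
      using BA by (intro nn_integral_bind_prob_algebra[OF P k, symmetric] borel_measurable_indicator) (auto simp: X)
    also have "\<dots> = emeasure (P \<bind> k) X"
      using BA by (intro nn_integral_indicator) (auto simp: X Pk)
    finally show "emeasure (distr P (?H \<Otimes>\<^sub>M S) (\<lambda>\<omega>. (past Z t \<omega>, Z t \<omega>))) X = emeasure (P \<bind> k) X" .
  next
    show "emeasure (distr P (?H \<Otimes>\<^sub>M S) (\<lambda>\<omega>. (past Z t \<omega>, Z t \<omega>))) (space ?H \<times> space S) \<noteq> \<infinity>" for i :: nat
      using mp by (simp add: emeasure_distr emeasure_eq_measure)
  qed (auto simp: sets_pair_measure Pk intro: sets.top dest: sets.sets_into_space)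
  then have "(\<integral>\<^sup>+y. g y \<partial>distr P (?H \<Otimes>\<^sub>M S) (\<lambda>\<omega>. (past Z t \<omega>, Z t \<omega>))) = (\<integral>\<^sup>+y. g y \<partial>(P \<bind> k))"
    by simp
  also have "\<dots> = (\<integral>\<^sup>+\<omega>. \<integral>\<^sup>+z. g (past Z t \<omega>, z) \<partial>p t (past Z t \<omega>) \<partial>P)"
    unfolding nn_integral_bind_prob_algebra[OF P k g] by (intro nn_integral_cong int_k g)
  finally show ?thesis
    using mp g by (simp add: nn_integral_distr)
qed

text \<open>
  The first \<open>n\<close> tangent variables are drawn at the end, the remaining ones interleaved with the
  process; the value does not depend on \<open>n\<close>. The cases \<open>n = 0\<close> and \<open>n = T\<close> connect the random tree
  with the process.
\<close>

lemma nn_integral_tangent_process: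
  assumes g: "g \<in> borel_measurable (histories S (Suc T) \<Otimes>\<^sub>M histories S (Suc T))"
  shows "n \<le> T \<Longrightarrow> (\<integral>\<^sup>+\<omega>. \<integral>\<^sup>+h'. path_integral p g (T - n) (Suc n) (past Z (Suc n) \<omega>, h')
      \<partial>tangent_law S p n (past Z (Suc n) \<omega>) \<partial>P) = path_integral p g T 1 (\<lambda>_. undefined, \<lambda>_. undefined)"
proof (induction n)
  case 0
  let ?u = "\<lambda>_. undefined :: 'z"
  have u: "?u \<in> space (histories S 1)" by (simp add: space_PiM)
  \<comment> \<open>Before time 1 there is a single history, and the tangent law is the point mass
    at it.\<close>
  have past: "past Z 1 \<omega> = ?u" for \<omega> by (simp add: past_def fun_eq_iff)
  have m: "(\<lambda>h'. path_integral p g T 1 (?u, h')) \<in> borel_measurable (histories S 1)"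
    by (rule measurable_compose[OF measurable_Pair1'[OF u] measurable_path_integral[OF g]]) auto
  have "(\<integral>\<^sup>+h'. path_integral p g T 1 (?u, h') \<partial>tangent_law S p 0 ?u) = path_integral p g T 1 (?u, ?u)"
    unfolding tangent_law.simps by (rule nn_integral_return[OF u m])
  then have "(\<integral>\<^sup>+\<omega>. \<integral>\<^sup>+h'. path_integral p g T 1 (?u, h') \<partial>tangent_law S p 0 ?u \<partial>P) =
      path_integral p g T 1 (?u, ?u)"
    by (simp only: nn_integral_const emeasure_space_1 mult_1_right)
  then show ?case by (simp only: past diff_zero flip: One_nat_def)
next
  case (Suc n)
  let ?t = "Suc n"
  let ?J = "path_integral p g (T - ?t) (Suc ?t)"
  have Tn: "T - n = Suc (T - ?t)" using Suc.prems by simp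
  have J: "?J \<in> borel_measurable (histories S (Suc ?t) \<Otimes>\<^sub>M histories S (Suc ?t))"
    using Suc.prems by (intro measurable_path_integral[OF g]) auto
  have past: "past Z ?t \<omega> \<in> space (histories S ?t)" "past Z (Suc ?t) \<omega> \<in> space (histories S (Suc ?t))"
    if "\<omega> \<in> space P" for \<omega>
    using measurable_space[OF measurable_past that] Suc.prems by auto
  have TL: "tangent_law S p n \<in> histories S ?t \<rightarrow>\<^sub>M prob_algebra (histories S ?t)"
    using Suc.prems by (intro measurable_tangent_law) auto
  have pt: "p ?t \<in> histories S ?t \<rightarrow>\<^sub>M prob_algebra S"
    using Suc.prems by (intro kernel) auto
  have u: "1 \<le> ?t" by simp
  \<comment> \<open>Here the process has run through \<open>fst x\<close> and takes the value
    \<open>snd x\<close> at time \<open>?t\<close>; the tangent variables up to \<open>?t\<close>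
    are integrated out.\<close>
  define \<psi> where "\<psi> = (\<lambda>x. \<integral>\<^sup>+h'. \<integral>\<^sup>+z'. ?J ((fst x)(?t := snd x), h'(?t := z')) \<partial>p ?t (fst x) \<partial>tangent_law S p n (fst x))"
  let ?H = "histories S ?t"
  have "(\<lambda>y. ?J ((fst (fst (fst y)))(?t := snd (fst (fst y))), (snd (fst y))(?t := snd y)))
      \<in> borel_measurable (((?H \<Otimes>\<^sub>M S) \<Otimes>\<^sub>M ?H) \<Otimes>\<^sub>M S)"
    by (intro measurable_compose[OF _ J] measurable_Pair measurable_update_history) simp_all
  then have m1: "(\<lambda>y. \<integral>\<^sup>+z'. ?J ((fst (fst y))(?t := snd (fst y)), (snd y)(?t := z')) \<partial>p ?t (fst (fst y)))
      \<in> borel_measurable ((?H \<Otimes>\<^sub>M S) \<Otimes>\<^sub>M ?H)"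
    by (intro nn_integral_measurable_subprob_algebra2[where N=S] measurable_prob_algebraD
        measurable_compose[OF _ pt]) (simp_all add: case_prod_beta')
  then have psi: "\<psi> \<in> borel_measurable (?H \<Otimes>\<^sub>M S)"
    unfolding \<psi>_def
    by (intro nn_integral_measurable_subprob_algebra2[where N="?H"] measurable_prob_algebraD
        measurable_compose[OF _ TL]) (simp_all add: case_prod_beta')
  have "path_integral p g T 1 (\<lambda>_. undefined, \<lambda>_. undefined) =
    (\<integral>\<^sup>+\<omega>. \<integral>\<^sup>+h'. path_integral p g (T - n) ?t (past Z ?t \<omega>, h') \<partial>tangent_law S p n (past Z ?t \<omega>) \<partial>P)"
    using Suc by simp
  \<comment> \<open>Given the past, the new value of the process is independent of the earlier
    tangent variables, so it may be drawn before them.\<close>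
  also have "\<dots> = (\<integral>\<^sup>+\<omega>. \<integral>\<^sup>+z. \<psi> (past Z ?t \<omega>, z) \<partial>p ?t (past Z ?t \<omega>) \<partial>P)"
  proof (rule nn_integral_cong)
    fix \<omega> assume "\<omega> \<in> space P"
    note h = past(1)[OF this]
    have TLs: "tangent_law S p n (past Z ?t \<omega>) \<in> space (prob_algebra ?H)"
      by (rule measurable_space[OF TL h])
    have pts: "p ?t (past Z ?t \<omega>) \<in> space (prob_algebra S)"
      by (rule measurable_space[OF pt h])
    have "(\<lambda>y. ((past Z ?t \<omega>, snd y), fst y)) \<in> ?H \<Otimes>\<^sub>M S \<rightarrow>\<^sub>M (?H \<Otimes>\<^sub>M S) \<Otimes>\<^sub>M ?H"
      using h by (intro measurable_Pair) simp_all
    from measurable_compose[OF this m1]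
    have "(\<lambda>(h', z). \<integral>\<^sup>+z'. ?J ((past Z ?t \<omega>)(?t := z), h'(?t := z')) \<partial>p ?t (past Z ?t \<omega>))
      \<in> borel_measurable (?H \<Otimes>\<^sub>M S)"
      by (simp add: case_prod_beta')
    from nn_integral_swap_prob_algebra[OF TLs pts this]
    show "(\<integral>\<^sup>+h'. path_integral p g (T - n) ?t (past Z ?t \<omega>, h') \<partial>tangent_law S p n (past Z ?t \<omega>)) =
      (\<integral>\<^sup>+z. \<psi> (past Z ?t \<omega>, z) \<partial>p ?t (past Z ?t \<omega>))"
      unfolding Tn path_integral.simps \<psi>_def fst_conv snd_conv .
  qed
  \<comment> \<open>The fresh draw becomes the observation itself.\<close>
  also have "\<dots> = (\<integral>\<^sup>+\<omega>. \<psi> (past Z ?t \<omega>, Z ?t \<omega>) \<partial>P)"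
    using Suc.prems by (intro disintegration[symmetric] psi) auto
  \<comment> \<open>The tangent variable at \<open>?t\<close> is drawn given the past before
    \<open>?t\<close> only, so it can be absorbed into \<open>tangent_law\<close>.\<close>
  also have "\<dots> = (\<integral>\<^sup>+\<omega>. \<integral>\<^sup>+h'. ?J (past Z (Suc ?t) \<omega>, h') \<partial>tangent_law S p ?t (past Z (Suc ?t) \<omega>) \<partial>P)"
  proof (rule nn_integral_cong)
    fix \<omega> assume "\<omega> \<in> space P"
    note h = past(2)[OF this]
    have "(\<integral>\<^sup>+h'. ?J (past Z (Suc ?t) \<omega>, h') \<partial>tangent_law S p ?t (past Z (Suc ?t) \<omega>)) =
      (\<integral>\<^sup>+h'. \<integral>\<^sup>+z'. ?J (past Z (Suc ?t) \<omega>, h'(?t := z')) \<partial>p ?t (past Z ?t \<omega>) \<partial>tangent_law S p n (past Z ?t \<omega>))"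
      using nn_integral_tangent_law_Suc[OF Suc.prems h measurable_compose[OF measurable_Pair1'[OF h] J]]
      unfolding restrict_past[OF le_SucI[OF order_refl]] .
    then show "\<psi> (past Z ?t \<omega>, Z ?t \<omega>) =
      (\<integral>\<^sup>+h'. ?J (past Z (Suc ?t) \<omega>, h') \<partial>tangent_law S p ?t (past Z (Suc ?t) \<omega>))"
      unfolding \<psi>_def fst_conv snd_conv past_Suc[OF u] by (rule sym)
  qed
  finally show ?case by (rule sym)
qed

end

section \<open>Symmetrization\<close>

lemma sum_lessThan_add: "(\<Sum>i<m + n. g i) = (\<Sum>i<m. g i) + (\<Sum>i<n. g (m + i))" for g :: "nat \<Rightarrow> 'a::comm_monoid_add"
  by (induction n) (simp_all add: add.assoc)

text \<open>Measurability of the class is relative to the completion of one law. The Borel version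
  is set to infinity on the exceptional null set: it then majorizes everywhere, as needed for a
  bound at every sample point, and is exact almost everywhere, as needed for its integral.\<close>

lemma measurable_class_majorant:
  fixes a :: "nat \<Rightarrow> real"
  assumes F: "measurable_class S F" and \<mu>: "\<mu> \<in> space (prob_algebra (\<Pi>\<^sub>M i\<in>{..<n}. S))"
  obtains g :: "(nat \<Rightarrow> 'z) \<Rightarrow> ennreal" and N where "g \<in> borel_measurable (\<Pi>\<^sub>M i\<in>{..<n}. S)" "N \<in> null_sets \<mu>"
    "\<And>y. y \<in> space (\<Pi>\<^sub>M i\<in>{..<n}. S) \<Longrightarrow> ennreal (exp (l * (SUP f\<in>F. \<Sum>i<n. a i * f (y i)))) \<le> g y"
    "\<And>y. y \<in> space (\<Pi>\<^sub>M i\<in>{..<n}. S) \<Longrightarrow> y \<notin> N \<Longrightarrow> g y = ennreal (exp (l * (SUP f\<in>F. \<Sum>i<n. a i * f (y i))))"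
proof -
  let ?X = "\<lambda>y. SUP f\<in>F. \<Sum>i<n. a i * f (y i)"
  note \<mu> = prob_algebraD[OF \<mu>]
  have "?X \<in> borel_measurable (completion \<mu>)"
    using F \<mu> unfolding measurable_class_def by blast
  from completion_ex_borel_measurable_real[OF this] obtain g1
    where g1: "g1 \<in> borel_measurable \<mu>" "AE y in \<mu>. ?X y = g1 y" by blast
  from AE_E3[OF g1(2)] obtain N where N: "\<And>y. y \<in> space \<mu> - N \<Longrightarrow> ?X y = g1 y" "N \<in> null_sets \<mu>" by blast
  define g where "g = (\<lambda>y. if y \<in> N then \<infinity> else ennreal (exp (l * g1 y)))"
  have "N \<in> sets \<mu>" using N(2) by auto
  then have "g \<in> borel_measurable \<mu>"
    unfolding g_def using g1(1) by measurable
  then have "g \<in> borel_measurable (\<Pi>\<^sub>M i\<in>{..<n}. S)"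
    using \<mu>(2) by (simp cong: measurable_cong_sets)
  then show ?thesis
    using N \<mu>(3) by (intro that[of g N]) (auto simp: g_def)
qed

text \<open>
  Arranges a pair of histories as one sample of size \<open>2 T\<close>, to which the measurability of the class
  applies.
\<close>

definition split_paths :: "nat \<Rightarrow> (nat \<Rightarrow> 'z) \<times> (nat \<Rightarrow> 'z) \<Rightarrow> nat \<Rightarrow> 'z" where
  "split_paths T x = (\<lambda>i\<in>{..<T + T}. if i < T then snd x (Suc i) else fst x (Suc (i - T)))"

lemma measurable_split_paths:
  "split_paths T \<in> histories S (Suc T) \<Otimes>\<^sub>M histories S (Suc T) \<rightarrow>\<^sub>M (\<Pi>\<^sub>M i\<in>{..<T + T}. S)"
  unfolding split_paths_def
proof (rule measurable_restrict)
  fix i assume "i \<in> {..<T + T}"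
  then show "(\<lambda>x. if i < T then snd x (Suc i) else fst x (Suc (i - T)))
      \<in> histories S (Suc T) \<Otimes>\<^sub>M histories S (Suc T) \<rightarrow>\<^sub>M S"
    using measurable_compose[OF measurable_snd measurable_component_singleton[of "Suc i" "{1..<Suc T}" "\<lambda>_. S"]]
      measurable_compose[OF measurable_fst measurable_component_singleton[of "Suc (i - T)" "{1..<Suc T}" "\<lambda>_. S"]]
    by (cases "i < T") auto
qed

lemma sum_split_paths:
  fixes f :: "'z \<Rightarrow> real"
  shows "(\<Sum>i<T + T. (if i < T then q (Suc i) else - q (Suc (i - T))) * f (split_paths T x i)) =
    (\<Sum>i<T. q (Suc i) * (f (snd x (Suc i)) - f (fst x (Suc i))))"
  unfolding sum_lessThan_add by (simp add: split_paths_def algebra_simps sum_negf sum_subtractf)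

section \<open>Comparison of the process with the random tree\<close>

context conditional_process
begin

abbreviation (input) start :: "(nat \<Rightarrow> 'z) \<times> (nat \<Rightarrow> 'z)" where
  "start \<equiv> (\<lambda>_. undefined, \<lambda>_. undefined)"

abbreviation (input) tree_pair_law :: "(bool list \<Rightarrow> 'z \<times> 'z) measure" where
  "tree_pair_law \<equiv> pair_tree_law S p T 1 (\<lambda>_. undefined)"

lemma start_in_space: "start \<in> space (histories S 1 \<Otimes>\<^sub>M histories S 1)"
  by (simp add: space_pair_measure space_PiM)

lemma tree_pair_law_in_space: "tree_pair_law \<in> space (prob_algebra (pair_trees S T))"
  by (intro pair_tree_law_in_space) (simp_all add: space_PiM)

lemma measurable_walk_start:
  assumes "length \<sigma> = T"
  shows "(\<lambda>w. walk \<sigma> 1 w start) \<in> pair_trees S T \<rightarrow>\<^sub>M histories S (Suc T) \<Otimes>\<^sub>M histories S (Suc T)"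
proof -
  have "(\<lambda>w. (w, start)) \<in> pair_trees S T \<rightarrow>\<^sub>M pair_trees S T \<Otimes>\<^sub>M (histories S 1 \<Otimes>\<^sub>M histories S 1)"
    by (intro measurable_Pair measurable_const start_in_space) simp
  from measurable_compose[OF this[folded assms] measurable_walk[of 1 \<sigma>]] show ?thesis
    by (simp add: assms)
qed

lemma nn_integral_walk_start:
  assumes "g \<in> borel_measurable (histories S (Suc T) \<Otimes>\<^sub>M histories S (Suc T))" "length \<sigma> = T"
  shows "(\<integral>\<^sup>+w. g (walk \<sigma> 1 w start) \<partial>tree_pair_law) = path_integral p g T 1 start"
  using nn_integral_walk[OF assms(1) _ _ start_in_space, of \<sigma>] assms(2) by simp

text \<open>The integrals along all walks agree with one \<open>path_integral\<close>, so all walks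
  have the same law, and a null set found for one sign sequence is null for every other.\<close>

lemma AE_walk_not_null:
  assumes \<phi>: "\<phi> \<in> histories S (Suc T) \<Otimes>\<^sub>M histories S (Suc T) \<rightarrow>\<^sub>M R" and \<tau>: "length \<tau> = T"
    and N: "N \<in> null_sets (distr tree_pair_law R (\<lambda>w. \<phi> (walk \<tau> 1 w start)))" and \<sigma>: "length \<sigma> = T"
  shows "AE w in tree_pair_law. \<phi> (walk \<sigma> 1 w start) \<notin> N"
proof -
  note W = prob_algebraD[OF tree_pair_law_in_space]
  have NR: "N \<in> sets R" using N by (auto simp: null_sets_def)
  have m: "(\<lambda>w. \<phi> (walk \<upsilon> 1 w start)) \<in> tree_pair_law \<rightarrow>\<^sub>M R" if "length \<upsilon> = T" for \<upsilon>
    using measurable_compose[OF measurable_walk_start[OF that] \<phi>] W(2) by (simp cong: measurable_cong_sets)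
  have i: "(\<lambda>x. indicator N (\<phi> x) :: ennreal) \<in> borel_measurable (histories S (Suc T) \<Otimes>\<^sub>M histories S (Suc T))"
    by (rule measurable_compose[OF \<phi> borel_measurable_indicator[OF NR]])
  have "0 = (\<integral>\<^sup>+w. indicator N (\<phi> (walk \<tau> 1 w start)) \<partial>tree_pair_law)"
    using N NR m[OF \<tau>] by (simp add: null_sets_def nn_integral_distr flip: nn_integral_indicator)
  also have "\<dots> = (\<integral>\<^sup>+w. indicator N (\<phi> (walk \<sigma> 1 w start)) \<partial>tree_pair_law)"
    unfolding nn_integral_walk_start[OF i \<tau>] nn_integral_walk_start[OF i \<sigma>] ..
  finally have "(\<integral>\<^sup>+w. indicator N (\<phi> (walk \<sigma> 1 w start)) \<partial>tree_pair_law) = 0" ..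
  then have "AE w in tree_pair_law. (indicator N (\<phi> (walk \<sigma> 1 w start)) :: ennreal) = 0"
    by (rule nn_integral_0_iff_AE[THEN iffD1, rotated])
       (rule measurable_compose[OF m[OF \<sigma>] borel_measurable_indicator[OF NR]])
  then show ?thesis by eventually_elim (simp add: indicator_def split: if_splits)
qed

text \<open>The supremum over \<open>f\<close> need not be measurable in \<open>\<omega>\<close>, so
  a measurable \<open>D\<close> above the exponential of every single \<open>f\<close> is produced
  instead. It averages a majorant of the symmetrized supremum over the tangent sequence given the
  process. \<open>N\<close> is left arbitrary so that the infimum defining the outer expectation can
  be taken afterwards.\<close>

lemma symmetrization:
  assumes F: "F \<noteq> {}" "\<And>f. f \<in> F \<Longrightarrow> f \<in> borel_measurable S"
    and bound: "\<And>f z. f \<in> F \<Longrightarrow> z \<in> space S \<Longrightarrow> 0 \<le> f z \<and> f z \<le> M"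
    and meas: "measurable_class S F" and q: "\<exists>t\<in>{1..T}. q t \<noteq> 0" and l: "0 < l"
    and N: "N \<in> borel_measurable (tree_law S p T)"
      "\<And>v. v \<in> space (tree_law S p T) \<Longrightarrow> ennreal_of_enat (covering_number T q \<alpha> F v) \<le> N v"
  obtains D where "D \<in> borel_measurable P"
    "\<And>\<omega> f. \<omega> \<in> space P \<Longrightarrow> f \<in> F \<Longrightarrow>
      ennreal (exp (l * (\<Sum>t=1..T. q t * (cond_expectation p Z t f \<omega> - f (Z t \<omega>))))) \<le> D \<omega>"
    "(\<integral>\<^sup>+\<omega>. D \<omega> \<partial>P) \<le>
      ennreal (exp (2 * l * \<alpha> + l\<^sup>2 * M\<^sup>2 * (L2_set q {1..T})\<^sup>2 / 2)) * (\<integral>\<^sup>+v. N v \<partial>tree_law S p T)"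
proof -
  let ?H = "histories S (Suc T)" and ?W = "tree_pair_law" and ?R = "\<Pi>\<^sub>M i\<in>{..<T + T}. S"
  define a where "a = (\<lambda>i. if i < T then q (Suc i) else - q (Suc (i - T)))"
  define E where "E = exp (2 * l * \<alpha> + l\<^sup>2 * M\<^sup>2 * (L2_set q {1..T})\<^sup>2 / 2)"
  define Y where "Y = (\<lambda>(x :: (nat \<Rightarrow> 'z) \<times> (nat \<Rightarrow> 'z)) (f :: 'z \<Rightarrow> real). \<Sum>i<T. q (Suc i) * (f (snd x (Suc i)) - f (fst x (Suc i))))"
  note W = prob_algebraD[OF tree_pair_law_in_space]
  have Y: "(\<Sum>i<T + T. a i * f (split_paths T x i)) = Y x f" for f x
    unfolding a_def Y_def by (rule sum_split_paths)
  \<comment> \<open>Any sign sequence would do, as all walks have the same law.\<close>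
  define \<tau> where "\<tau> = replicate T True"
  have \<tau>: "length \<tau> = T" by (simp add: \<tau>_def)
  define \<mu> where "\<mu> = distr ?W ?R (\<lambda>w. split_paths T (walk \<tau> 1 w start))"
  have "(\<lambda>w. split_paths T (walk \<tau> 1 w start)) \<in> ?W \<rightarrow>\<^sub>M ?R"
    using measurable_compose[OF measurable_walk_start[OF \<tau>] measurable_split_paths] W(2)
    by (simp cong: measurable_cong_sets)
  then have \<mu>: "\<mu> \<in> space (prob_algebra ?R)"
    using prob_space.prob_space_distr[OF W(1)] by (simp add: \<mu>_def space_prob_algebra)
  obtain g0 N0 where g0: "g0 \<in> borel_measurable ?R" "N0 \<in> null_sets \<mu>"
    "\<And>y. y \<in> space ?R \<Longrightarrow> ennreal (exp (l * (SUP f\<in>F. \<Sum>i<T + T. a i * f (y i)))) \<le> g0 y"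
    "\<And>y. y \<in> space ?R \<Longrightarrow> y \<notin> N0 \<Longrightarrow> g0 y = ennreal (exp (l * (SUP f\<in>F. \<Sum>i<T + T. a i * f (y i))))"
    by (rule measurable_class_majorant[OF meas \<mu>, where l=l and a=a], rule that)
  define g where "g = (\<lambda>x. g0 (split_paths T x))"
  have g: "g \<in> borel_measurable (?H \<Otimes>\<^sub>M ?H)"
    unfolding g_def by (rule measurable_compose[OF measurable_split_paths g0(1)])
  have g_ge: "ennreal (exp (l * (SUP f\<in>F. Y x f))) \<le> g x" if "x \<in> space (?H \<Otimes>\<^sub>M ?H)" for x
    using g0(3)[OF measurable_space[OF measurable_split_paths that]] by (simp add: g_def Y)
  have g_eq: "g x = ennreal (exp (l * (SUP f\<in>F. Y x f)))"
    if "x \<in> space (?H \<Otimes>\<^sub>M ?H)" "split_paths T x \<notin> N0" for x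
    using g0(4)[OF measurable_space[OF measurable_split_paths that(1)] that(2)] by (simp add: g_def Y)

  have bdd: "bdd_above (Y x ` F)" if x: "x \<in> space (?H \<Otimes>\<^sub>M ?H)" for x
  proof (rule bdd_aboveI2)
    fix f assume f: "f \<in> F"
    show "Y x f \<le> (\<Sum>i<T. \<bar>q (Suc i)\<bar> * M)"
      unfolding Y_def
    proof (rule sum_mono)
      fix i assume "i \<in> {..<T}"
      then have "fst x (Suc i) \<in> space S" "snd x (Suc i) \<in> space S"
        using x by (auto simp: space_pair_measure space_PiM PiE_iff)
      then have "\<bar>f (snd x (Suc i)) - f (fst x (Suc i))\<bar> \<le> M"
        using bound[OF f, of "fst x (Suc i)"] bound[OF f, of "snd x (Suc i)"] by auto
      then have "\<bar>q (Suc i)\<bar> * \<bar>f (snd x (Suc i)) - f (fst x (Suc i))\<bar> \<le> \<bar>q (Suc i)\<bar> * M"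
        by (rule mult_left_mono) simp
      then show "q (Suc i) * (f (snd x (Suc i)) - f (fst x (Suc i))) \<le> \<bar>q (Suc i)\<bar> * M"
        unfolding abs_mult[symmetric] by (rule abs_le_D1)
    qed
  qed

  define D where "D = (\<lambda>\<omega>. \<integral>\<^sup>+h'. g (past Z (Suc T) \<omega>, h') \<partial>tangent_law S p T (past Z (Suc T) \<omega>))"
  have past: "past Z (Suc T) \<in> P \<rightarrow>\<^sub>M ?H" by (rule measurable_past) simp
  have "(\<lambda>h. \<integral>\<^sup>+h'. g (h, h') \<partial>tangent_law S p T h) \<in> borel_measurable ?H"
    using g by (intro nn_integral_measurable_subprob_algebra2[where N="?H"] measurable_prob_algebraD
        measurable_tangent_law) simp_all
  from measurable_compose[OF past this] have D: "D \<in> borel_measurable P"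
    by (simp add: D_def)
  have D_ge: "ennreal (exp (l * (\<Sum>t=1..T. q t * (cond_expectation p Z t f \<omega> - f (Z t \<omega>))))) \<le> D \<omega>"
    if \<omega>: "\<omega> \<in> space P" and f: "f \<in> F" for \<omega> f
  proof -
    let ?h = "past Z (Suc T) \<omega>"
    note h = measurable_space[OF past \<omega>]
    have "(\<Sum>t=1..T. q t * (cond_expectation p Z t f \<omega> - f (Z t \<omega>))) =
      (\<Sum>i<T. q (Suc i) * ((\<integral>z. f z \<partial>p (Suc i) (restrict ?h {1..<Suc i})) - f (Z (Suc i) \<omega>)))"
      unfolding One_nat_def sum.atLeast1_atMost_eq cond_expectation_def
    proof (rule sum.cong[OF refl])
      fix i assume "i \<in> {..<T}"
      then have "restrict ?h {1..<Suc i} = past Z (Suc i) \<omega>" by (intro restrict_past) simp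
      then show "q (Suc i) * ((\<integral>z. f z \<partial>p (Suc i) (past Z (Suc i) \<omega>)) - f (Z (Suc i) \<omega>)) =
          q (Suc i) * ((\<integral>z. f z \<partial>p (Suc i) (restrict ?h {Suc 0..<Suc i})) - f (Z (Suc i) \<omega>))"
        by simp
    qed
    then have "l * (\<Sum>t=1..T. q t * (cond_expectation p Z t f \<omega> - f (Z t \<omega>))) =
      (\<Sum>i<T. l * q (Suc i) * ((\<integral>z. f z \<partial>p (Suc i) (restrict ?h {1..<Suc i})) - f (Z (Suc i) \<omega>)))"
      by (simp only: sum_distrib_left mult.assoc)
    then have "ennreal (exp (l * (\<Sum>t=1..T. q t * (cond_expectation p Z t f \<omega> - f (Z t \<omega>))))) =
      ennreal (exp (\<Sum>i<T. l * q (Suc i) * ((\<integral>z. f z \<partial>p (Suc i) (restrict ?h {1..<Suc i})) - f (Z (Suc i) \<omega>))))"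
      by (simp only:)
    also have "\<dots> \<le>
        (\<integral>\<^sup>+h'. ennreal (exp (\<Sum>i<T. l * q (Suc i) * (f (h' (Suc i)) - f (Z (Suc i) \<omega>)))) \<partial>tangent_law S p T ?h)"
      using bound[OF f] by (intro jensen_tangent_law[where B=M] F(2) f h) auto
    also have "\<dots> \<le> D \<omega>"
      unfolding D_def
    proof (rule nn_integral_mono)
      fix h' assume "h' \<in> space (tangent_law S p T ?h)"
      then have "h' \<in> space ?H"
        using prob_algebraD(3)[OF tangent_law_in_space[OF order_refl h]] by (simp only:)
      then have x: "(?h, h') \<in> space (?H \<Otimes>\<^sub>M ?H)"
        using h by (simp add: space_pair_measure)
      have "(\<Sum>i<T. l * q (Suc i) * (f (h' (Suc i)) - f (Z (Suc i) \<omega>))) = l * Y (?h, h') f"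
        unfolding Y_def sum_distrib_left mult.assoc by (rule sum.cong) (simp_all add: past_def)
      also have "\<dots> \<le> l * (SUP f\<in>F. Y (?h, h') f)"
        using l by (intro mult_left_mono cSUP_upper f bdd[OF x]) simp
      finally show "ennreal (exp (\<Sum>i<T. l * q (Suc i) * (f (h' (Suc i)) - f (Z (Suc i) \<omega>)))) \<le> g (?h, h')"
        by (intro order_trans[OF _ g_ge[OF x]] ennreal_leI) (simp only: exp_le_cancel_iff)
    qed
    finally show ?thesis .
  qed

  let ?\<Sigma> = "{\<sigma>::bool list. length \<sigma> = T}"
  have fin: "finite ?\<Sigma>" using finite_lists_length_eq[of "UNIV::bool set" T] by simp
  have card: "card ?\<Sigma> = 2 ^ T" using card_lists_length_eq[of "UNIV::bool set" T] by (simp add: card_UNIV_bool)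
  have D_int: "(\<integral>\<^sup>+\<omega>. D \<omega> \<partial>P) = (\<integral>\<^sup>+w. g (walk \<sigma> 1 w start) \<partial>?W)" if "\<sigma> \<in> ?\<Sigma>" for \<sigma>
    using nn_integral_tangent_process[OF g order_refl] nn_integral_walk_start[OF g, of \<sigma>] that
    by (simp add: D_def)
  define v where "v = (\<lambda>w. \<lambda>s\<in>nodes T. fst (w s :: 'z \<times> 'z))"
  define v' where "v' = (\<lambda>w. \<lambda>s\<in>nodes T. snd (w s :: 'z \<times> 'z))"
  have v: "v \<in> pair_trees S T \<rightarrow>\<^sub>M (\<Pi>\<^sub>M s\<in>nodes T. S)"
    unfolding v_def by measurable
  have law: "tree_law S p T = distr ?W (\<Pi>\<^sub>M s\<in>nodes T. S) v"
    by (simp add: tree_law_def v_def)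
  have Nv: "(\<lambda>w. N (v w)) \<in> borel_measurable (pair_trees S T)"
    using N(1) by (intro measurable_compose[OF v]) (simp add: law)
  have cov: "ennreal_of_enat (covering_number T q \<alpha> F (v w)) \<le> N (v w)" if "w \<in> space (pair_trees S T)" for w
    using measurable_space[OF v that] by (intro N(2)) (simp add: law)
  \<comment> \<open>The reflected tree of second components is the tree of first components after
    the swap, which in turn preserves the law of the pair tree.\<close>
  have cov': "covering_number T q \<alpha> F (v' w) = covering_number T q \<alpha> F (v (swap_tree T w))" for w
  proof -
    have "reflect (v' w) = v (swap_tree T w)"
      by (auto simp: reflect_def v_def v'_def swap_tree_def nodes_def fun_eq_iff)
    then show ?thesis using covering_number_reflect[of T q \<alpha> F "v' w"] by simp
  qed
  have pointwise: "(\<Sum>\<sigma>\<in>?\<Sigma>. ennreal (exp (l * (SUP f\<in>F. Y (walk \<sigma> 1 w start) f)))) \<le>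
      ennreal (2 ^ T * (E / 2)) * (N (v w) + N (v (swap_tree T w)))"
    if w: "w \<in> space (pair_trees S T)" for w
  proof -
    have ws: "fst (w s) \<in> space S" "snd (w s) \<in> space S" if "s \<in> nodes T" for s
      using w that by (auto simp: space_PiM PiE_iff space_pair_measure mem_Times_iff)
    have "Y (walk \<sigma> 1 w start) f =
        (\<Sum>i<T. q (Suc i) * (bool_sign (\<sigma> ! i) * (f (v' w (take i \<sigma>)) - f (v w (take i \<sigma>)))))"
      if "length \<sigma> = T" for \<sigma> f
      unfolding Y_def
    proof (rule sum.cong[OF refl])
      fix i assume i: "i \<in> {..<T}"
      then have "take i \<sigma> \<in> nodes T" using that by (simp add: nodes_def)
      then show "q (Suc i) * (f (snd (walk \<sigma> 1 w start) (Suc i)) - f (fst (walk \<sigma> 1 w start) (Suc i))) =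
          q (Suc i) * (bool_sign (\<sigma> ! i) * (f (v' w (take i \<sigma>)) - f (v w (take i \<sigma>))))"
        using walk_nth[of i \<sigma> 1 w start] i that by (simp add: v_def v'_def)
    qed
    then have "(\<Sum>\<sigma>\<in>?\<Sigma>. ennreal (exp (l * (SUP f\<in>F. Y (walk \<sigma> 1 w start) f)))) =
        (\<Sum>\<sigma>\<in>?\<Sigma>. ennreal (exp (l * (SUP f\<in>F.
          \<Sum>i<T. q (Suc i) * (bool_sign (\<sigma> ! i) * (f (v' w (take i \<sigma>)) - f (v w (take i \<sigma>))))))))"
      by (intro sum.cong refl) (simp only: mem_Collect_eq)
    also have "\<dots> \<le> ennreal (2 ^ T * (E / 2)) *
      (ennreal_of_enat (covering_number T q \<alpha> F (v w)) + ennreal_of_enat (covering_number T q \<alpha> F (v' w)))"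
      unfolding E_def
      by (rule symmetrized_mgf_le_covering_number[OF F(1) _ _ q l])
         (use bound ws in \<open>simp_all add: v_def v'_def\<close>)
    also have "\<dots> \<le> ennreal (2 ^ T * (E / 2)) * (N (v w) + N (v (swap_tree T w)))"
      unfolding cov' by (intro mult_left_mono add_mono cov w measurable_space[OF measurable_swap_tree]) simp
    finally show ?thesis .
  qed
  have ae: "AE w in ?W. \<forall>\<sigma>\<in>?\<Sigma>. split_paths T (walk \<sigma> 1 w start) \<notin> N0"
    using g0(2) AE_walk_not_null[OF measurable_split_paths \<tau>]
    by (intro AE_finite_allI[OF fin]) (simp add: \<mu>_def)
  have gW: "(\<lambda>w. g (walk \<sigma> 1 w start)) \<in> borel_measurable ?W" if "\<sigma> \<in> ?\<Sigma>" for \<sigma>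
    using measurable_compose[OF measurable_walk_start g] that W(2) by (simp cong: measurable_cong_sets)
  have NvW: "(\<lambda>w. N (v w)) \<in> borel_measurable ?W" "(\<lambda>w. N (v (swap_tree T w))) \<in> borel_measurable ?W"
    using Nv measurable_compose[OF measurable_swap_tree Nv] W(2) by (simp_all cong: measurable_cong_sets)
  have int_N: "(\<integral>\<^sup>+w. N (v w) \<partial>?W) = (\<integral>\<^sup>+v. N v \<partial>tree_law S p T)"
    unfolding law using v N(1) W(2)
    by (intro nn_integral_distr[symmetric]) (simp_all add: law cong: measurable_cong_sets)
  have int_N': "(\<integral>\<^sup>+w. N (v (swap_tree T w)) \<partial>?W) = (\<integral>\<^sup>+v. N v \<partial>tree_law S p T)"
    unfolding int_N[symmetric] by (rule nn_integral_swap_tree[OF _ _ _ Nv]) (simp_all add: space_PiM)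
  \<comment> \<open>The average over the sign sequences with the denominator cleared: all
    \<open>2 ^ T\<close> integrals are equal.\<close>
  have "2 ^ T * (\<integral>\<^sup>+\<omega>. D \<omega> \<partial>P) = (\<Sum>\<sigma>\<in>?\<Sigma>. \<integral>\<^sup>+\<omega>. D \<omega> \<partial>P)"
    unfolding sum_constant card by simp
  also have "\<dots> = (\<Sum>\<sigma>\<in>?\<Sigma>. \<integral>\<^sup>+w. g (walk \<sigma> 1 w start) \<partial>?W)"
    by (intro sum.cong refl D_int)
  also have "\<dots> = (\<integral>\<^sup>+w. (\<Sum>\<sigma>\<in>?\<Sigma>. g (walk \<sigma> 1 w start)) \<partial>?W)"
    by (rule nn_integral_sum[symmetric]) (rule gW)
  also have "\<dots> \<le> (\<integral>\<^sup>+w. ennreal (2 ^ T * (E / 2)) * (N (v w) + N (v (swap_tree T w))) \<partial>?W)"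
  proof (rule nn_integral_mono_AE)
    from ae AE_space show "AE w in ?W. (\<Sum>\<sigma>\<in>?\<Sigma>. g (walk \<sigma> 1 w start)) \<le>
        ennreal (2 ^ T * (E / 2)) * (N (v w) + N (v (swap_tree T w)))"
    proof eventually_elim
      case (elim w)
      then have w: "w \<in> space (pair_trees S T)" by (simp only: W(3))
      have "(\<Sum>\<sigma>\<in>?\<Sigma>. g (walk \<sigma> 1 w start)) = (\<Sum>\<sigma>\<in>?\<Sigma>. ennreal (exp (l * (SUP f\<in>F. Y (walk \<sigma> 1 w start) f))))"
        using elim measurable_space[OF measurable_walk_start w] by (intro sum.cong refl g_eq) auto
      with pointwise[OF w] show ?case by simp
    qed
  qed
  also have "\<dots> = ennreal (2 ^ T * (E / 2)) * ((\<integral>\<^sup>+v. N v \<partial>tree_law S p T) + (\<integral>\<^sup>+v. N v \<partial>tree_law S p T))"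
    by (simp only: nn_integral_cmult nn_integral_add int_N int_N' NvW borel_measurable_add)
  also have "\<dots> = 2 ^ T * (ennreal E * (\<integral>\<^sup>+v. N v \<partial>tree_law S p T))"
  proof -
    have "ennreal (2 ^ T * (E / 2)) = 2 ^ T * ennreal (E / 2)"
      by (subst ennreal_mult) (simp_all add: E_def flip: ennreal_power)
    moreover have "ennreal (E / 2) * (x + x) = ennreal E * x" for x
    proof -
      have "ennreal (E / 2) * (x + x) = (ennreal (E / 2) + ennreal (E / 2)) * x"
        by (simp only: distrib_left distrib_right)
      also have "ennreal (E / 2) + ennreal (E / 2) = ennreal E"
        by (subst ennreal_plus[symmetric]) (simp_all add: E_def)
      finally show ?thesis .
    qed
    ultimately show ?thesis by (simp add: mult.assoc)
  qed
  finally have "(\<integral>\<^sup>+\<omega>. D \<omega> \<partial>P) \<le> ennreal E * (\<integral>\<^sup>+v. N v \<partial>tree_law S p T)"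
    by (subst (asm) ennreal_mult_le_mult_iff) (simp_all add: power_eq_top_ennreal)
  then show ?thesis
    using that[OF D D_ge] by (simp add: E_def)
qed

end

section \<open>The deviation bound\<close>

lemma (in prob_space) abs_integral_le_bound:
  assumes "f \<in> borel_measurable M" "\<And>z. z \<in> space M \<Longrightarrow> \<bar>f z :: real\<bar> \<le> B"
  shows "\<bar>\<integral>z. f z \<partial>M\<bar> \<le> B"
proof -
  have f: "integrable M f"
    using assms by (intro integrable_const_bound[of _ B]) auto
  have "\<bar>\<integral>z. f z \<partial>M\<bar> \<le> (\<integral>z. \<bar>f z\<bar> \<partial>M)"
    by (rule integral_abs_bound)
  also have "\<dots> \<le> B"
    using f assms(2) by (intro integral_le_const) auto
  finally show ?thesis .
qed

lemma SUP_diff_le: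
  fixes u v :: "'a \<Rightarrow> real"
  assumes "A \<noteq> {}" "bdd_above (v ` A)" "\<And>x. x \<in> A \<Longrightarrow> u x - v x \<le> c"
  shows "(SUP x\<in>A. u x) - (SUP x\<in>A. v x) \<le> c"
proof -
  have "(SUP x\<in>A. u x) \<le> (SUP x\<in>A. v x) + c"
  proof (rule cSUP_least[OF assms(1)])
    fix x assume x: "x \<in> A"
    show "u x \<le> (SUP x\<in>A. v x) + c"
      using assms(3)[OF x] cSUP_upper[OF x assms(2)] by linarith
  qed
  then show ?thesis by linarith
qed

text \<open>Dividing by the positive real \<open>c\<close> first moves the constant out of the
  infimum, after which each measurable majorant can be treated separately.\<close>

lemma le_outer_expectation_mult:
  assumes "0 < c"
    and "\<And>g. g \<in> borel_measurable M \<Longrightarrow> (\<And>x. x \<in> space M \<Longrightarrow> f x \<le> g x) \<Longrightarrow> x \<le> (\<integral>\<^sup>+x. g x \<partial>M) * ennreal c"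
  shows "x \<le> outer_expectation M f * ennreal c"
proof -
  have c: "ennreal c * ennreal (1 / c) = 1"
    using assms(1) by (simp flip: ennreal_mult)
  have "x * ennreal (1 / c) \<le> outer_expectation M f"
    unfolding outer_expectation_def
  proof (rule INF_greatest)
    fix g assume "g \<in> {g \<in> borel_measurable M. \<forall>x\<in>space M. f x \<le> g x}"
    then have "x \<le> (\<integral>\<^sup>+x. g x \<partial>M) * ennreal c"
      by (intro assms(2)) auto
    then have "x * ennreal (1 / c) \<le> (\<integral>\<^sup>+x. g x \<partial>M) * ennreal c * ennreal (1 / c)"
      by (rule mult_right_mono) simp
    then show "x * ennreal (1 / c) \<le> (\<integral>\<^sup>+x. g x \<partial>M)"
      by (simp only: mult.assoc c mult_1_right)
  qed
  then have "x * ennreal (1 / c) * ennreal c \<le> outer_expectation M f * ennreal c"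
    by (rule mult_right_mono) simp
  then show ?thesis
    by (simp only: mult.assoc mult.commute[of "ennreal (1 / c)"] c mult_1_right)
qed

theorem theorem1:
  fixes P :: "'w measure"
    and MX :: "'x measure" and MY :: "'y measure"
    and Z :: "nat \<Rightarrow> 'w \<Rightarrow> 'x \<times> 'y"
    and p :: "nat \<Rightarrow> (nat \<Rightarrow> 'x \<times> 'y) \<Rightarrow> ('x \<times> 'y) measure"
    and L :: "'y \<Rightarrow> 'y \<Rightarrow> real"
    and H :: "('x \<Rightarrow> 'y) set"
    and q :: "nat \<Rightarrow> real"
    and T :: nat
    and M \<alpha> \<epsilon> :: real
  defines "F \<equiv> loss_class L H"
  assumes "prob_space P"
    and "\<And>t. t \<in> {1..T + 1} \<Longrightarrow> Z t \<in> P \<rightarrow>\<^sub>M MX \<Otimes>\<^sub>M MY"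
    and "\<And>t. t \<in> {1..T + 1} \<Longrightarrow> cond_distribution P (MX \<Otimes>\<^sub>M MY) Z t (p t)"
    and "\<And>h. h \<in> H \<Longrightarrow> h \<in> space MX \<rightarrow> space MY"
    and "\<And>y y'. y \<in> space MY \<Longrightarrow> y' \<in> space MY \<Longrightarrow> 0 \<le> L y y'"
    and "\<And>f. f \<in> F \<Longrightarrow> f \<in> borel_measurable (MX \<Otimes>\<^sub>M MY)"
    and "\<And>f z. f \<in> F \<Longrightarrow> z \<in> space (MX \<Otimes>\<^sub>M MY) \<Longrightarrow> \<bar>f z\<bar> \<le> M"
    and "measurable_class (MX \<Otimes>\<^sub>M MY) F"
    and "\<exists>t\<in>{1..T}. q t \<noteq> 0"
    and "0 < 2 * \<alpha>" and "2 * \<alpha> < \<epsilon>"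
  shows "outer_measure_of P {\<omega> \<in> space P. Phi p Z T F q \<omega> - disc p Z T F q \<omega> \<ge> \<epsilon>}
    \<le> outer_expectation (tree_law (MX \<Otimes>\<^sub>M MY) p T)
          (\<lambda>v. ennreal_of_enat (covering_number T q \<alpha> F v))
        * ennreal (exp (- ((\<epsilon> - 2 * \<alpha>)\<^sup>2 / (2 * M\<^sup>2 * (L2_set q {1..T})\<^sup>2))))"
proof (cases "F = {}")
  case True
  \<comment> \<open>Without losses both suprema are the same default value, so their difference is
    0, which is below \<open>\<epsilon>\<close>, and the event is empty.\<close>
  then show ?thesis
    using assms by (simp add: Phi_def disc_def)
next
  case False
  let ?S = "MX \<Otimes>\<^sub>M MY"
  interpret P: conditional_process P ?S Z p T
    by (intro conditional_process.intro conditional_process_axioms.intro assms(2-4)) auto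
  have F_nonneg: "0 \<le> f z" if f: "f \<in> F" and z: "z \<in> space ?S" for f z
  proof -
    obtain h where h: "h \<in> H" "f = (\<lambda>(x, y). L (h x) y)"
      using f by (auto simp: F_def loss_class_def)
    obtain x y where "z = (x, y)" "x \<in> space MX" "y \<in> space MY"
      using z by (auto simp: space_pair_measure)
    then show ?thesis
      using assms(6)[of "h x" y] assms(5)[OF h(1)] by (auto simp: h(2))
  qed
  have bound: "0 \<le> f z \<and> f z \<le> M" if "f \<in> F" "z \<in> space ?S" for f z
    using F_nonneg[OF that] assms(8)[OF that] by auto
  obtain f0 \<omega>0 where "f0 \<in> F" "\<omega>0 \<in> space P"
    using False P.not_empty by blast
  moreover have "T \<ge> 1" using assms(10) by auto
  ultimately have M: "0 \<le> M"
    using bound[of f0 "Z 1 \<omega>0"] measurable_space[OF P.random_variables[of 1]] by fastforce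
  define Q where "Q = M\<^sup>2 * (L2_set q {1..T})\<^sup>2"
  have L2: "0 < L2_set q {1..T}"
    using assms(10) by (auto simp: less_le L2_set_eq_0_iff)
  \<comment> \<open>The minimizer of the quadratic exponent. For \<open>M = 0\<close> the target
    exponent is 0 by division by zero, and any positive \<open>l\<close> makes the left side
    negative.\<close>
  define l where "l = (if M = 0 then 1 else (\<epsilon> - 2 * \<alpha>) / Q)"
  have Q: "0 < Q" if "M \<noteq> 0"
    using that L2 M by (simp add: Q_def)
  have l: "0 < l"
    using assms(12) Q by (auto simp: l_def)
  have exponent: "2 * l * \<alpha> + l\<^sup>2 * M\<^sup>2 * (L2_set q {1..T})\<^sup>2 / 2 - l * \<epsilon> \<le>
      - ((\<epsilon> - 2 * \<alpha>)\<^sup>2 / (2 * M\<^sup>2 * (L2_set q {1..T})\<^sup>2))"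
  proof (cases "M = 0")
    case True
    then show ?thesis using assms(12) by (simp add: l_def)
  next
    case False
    have "2 * l * \<alpha> + l\<^sup>2 * M\<^sup>2 * (L2_set q {1..T})\<^sup>2 / 2 - l * \<epsilon> = l\<^sup>2 * Q / 2 - l * (\<epsilon> - 2 * \<alpha>)"
      by (simp add: Q_def algebra_simps)
    also have "\<dots> = - ((\<epsilon> - 2 * \<alpha>)\<^sup>2 / (2 * Q))"
      using False Q by (simp add: l_def power2_eq_square field_simps)
    finally show ?thesis by (simp add: Q_def mult.assoc)
  qed
  have ce_bound: "\<bar>cond_expectation p Z t f \<omega>\<bar> \<le> M"
    if t: "t \<in> {1..T + 1}" and f: "f \<in> F" and \<omega>: "\<omega> \<in> space P" for t f \<omega>
  proof -
    have "past Z t \<omega> \<in> space (histories ?S t)"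
      using t by (intro measurable_space[OF P.measurable_past \<omega>]) simp
    then have "p t (past Z t \<omega>) \<in> space (prob_algebra ?S)"
      using assms(4)[OF t] by (intro measurable_space[of "p t"]) (auto simp: cond_distribution_def)
    note pt = prob_algebraD[OF this]
    show ?thesis
      unfolding cond_expectation_def
      using assms(7)[OF f] pt(2) assms(8)[OF f]
      by (intro prob_space.abs_integral_le_bound[OF pt(1)]) (simp_all add: pt(3) cong: measurable_cong_sets)
  qed
  let ?A = "{\<omega> \<in> space P. Phi p Z T F q \<omega> - disc p Z T F q \<omega> \<ge> \<epsilon>}"
  show ?thesis
  proof (rule le_outer_expectation_mult[OF exp_gt_zero])
    fix N assume N: "N \<in> borel_measurable (tree_law ?S p T)"
      "\<And>v. v \<in> space (tree_law ?S p T) \<Longrightarrow> ennreal_of_enat (covering_number T q \<alpha> F v) \<le> N v"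
    let ?I = "\<integral>\<^sup>+v. N v \<partial>tree_law ?S p T"
    let ?C = "exp (2 * l * \<alpha> + l\<^sup>2 * M\<^sup>2 * (L2_set q {1..T})\<^sup>2 / 2)"
    obtain D where D: "D \<in> borel_measurable P"
      "\<And>\<omega> f. \<omega> \<in> space P \<Longrightarrow> f \<in> F \<Longrightarrow>
        ennreal (exp (l * (\<Sum>t=1..T. q t * (cond_expectation p Z t f \<omega> - f (Z t \<omega>))))) \<le> D \<omega>"
      "(\<integral>\<^sup>+\<omega>. D \<omega> \<partial>P) \<le> ennreal ?C * ?I"
      by (rule P.symmetrization[where F=F and M=M and q=q and l=l and N=N and \<alpha>=\<alpha>], rule False,
          erule assms(7), erule (1) bound, rule assms(9), rule assms(10), rule l, rule N(1), erule N(2), rule that)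
    \<comment> \<open>A measurable event containing \<open>?A\<close>, in the form required by
      Markov's inequality.\<close>
    let ?B = "{\<omega> \<in> space P. 1 \<le> ennreal (exp (- l * \<epsilon>)) * D \<omega>}"
    have "?A \<subseteq> ?B"
    proof (intro subsetI, elim CollectE conjE, intro CollectI conjI)
      fix \<omega> assume \<omega>: "\<omega> \<in> space P" and dev: "Phi p Z T F q \<omega> - disc p Z T F q \<omega> \<ge> \<epsilon>"
      have "ennreal (exp (l * \<epsilon>)) \<le> D \<omega>"
      proof (rule ccontr)
        assume "\<not> ennreal (exp (l * \<epsilon>)) \<le> D \<omega>"
        then have less: "D \<omega> < ennreal (exp (l * \<epsilon>))" by simp
        \<comment> \<open>A value \<open>d\<close> below \<open>exp (l * \<epsilon>)\<close> bounds
          all \<open>f\<close> at once, which keeps the supremum strictly below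
          \<open>\<epsilon>\<close>; separate strict inequalities could become an equality in the
          supremum.\<close>
        then obtain d where d: "D \<omega> = ennreal d" "0 \<le> d"
          by (cases "D \<omega>") auto
        have d_less: "d < exp (l * \<epsilon>)"
          using less d by (simp add: ennreal_less_iff)
        have le_d: "exp (l * (\<Sum>t=1..T. q t * (cond_expectation p Z t f \<omega> - f (Z t \<omega>)))) \<le> d" if "f \<in> F" for f
          using D(2)[OF \<omega> that] d by simp
        have d_pos: "0 < d"
          using less_le_trans[OF exp_gt_zero le_d[OF \<open>f0 \<in> F\<close>]] .
        have "Phi p Z T F q \<omega> - disc p Z T F q \<omega> \<le> ln d / l"
          unfolding Phi_def disc_def
        proof (rule SUP_diff_le[OF False])
          show "bdd_above ((\<lambda>f. cond_expectation p Z (T + 1) f \<omega> -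
              (\<Sum>t = 1..T. q t * cond_expectation p Z t f \<omega>)) ` F)"
          proof (rule bdd_aboveI2)
            fix f assume f: "f \<in> F"
            have "- (q t * cond_expectation p Z t f \<omega>) \<le> \<bar>q t\<bar> * M" if "t \<in> {1..T}" for t
            proof -
              have "\<bar>q t\<bar> * \<bar>cond_expectation p Z t f \<omega>\<bar> \<le> \<bar>q t\<bar> * M"
                using that by (intro mult_left_mono ce_bound f \<omega>) auto
              then show ?thesis unfolding abs_mult[symmetric] by (rule abs_le_D2)
            qed
            from sum_mono[OF this] have "- (\<Sum>t=1..T. q t * cond_expectation p Z t f \<omega>) \<le> (\<Sum>t=1..T. \<bar>q t\<bar> * M)"
              by (simp only: sum_negf)
            moreover have "cond_expectation p Z (T + 1) f \<omega> \<le> M"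
              by (rule abs_le_D1[OF ce_bound[OF _ f \<omega>]]) simp
            ultimately show "cond_expectation p Z (T + 1) f \<omega> - (\<Sum>t = 1..T. q t * cond_expectation p Z t f \<omega>)
                \<le> M + (\<Sum>t=1..T. \<bar>q t\<bar> * M)"
              by linarith
          qed
          fix f assume f: "f \<in> F"
          have "l * (\<Sum>t=1..T. q t * (cond_expectation p Z t f \<omega> - f (Z t \<omega>))) \<le> ln d"
            using ln_mono[OF le_d[OF f] exp_gt_zero] by simp
          then have "(\<Sum>t=1..T. q t * (cond_expectation p Z t f \<omega> - f (Z t \<omega>))) \<le> ln d / l"
            unfolding pos_le_divide_eq[OF l] by (simp only: mult.commute)
          \<comment> \<open>The conditional expectation at time \<open>T + 1\<close> is common to
            both expressions and cancels.\<close>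
          then show "cond_expectation p Z (T + 1) f \<omega> - (\<Sum>t = 1..T. q t * f (Z t \<omega>)) -
              (cond_expectation p Z (T + 1) f \<omega> - (\<Sum>t = 1..T. q t * cond_expectation p Z t f \<omega>)) \<le> ln d / l"
            by (simp add: right_diff_distrib sum_subtractf)
        qed
        also have "ln d < l * \<epsilon>"
          using d_less d_pos by (metis exp_gt_zero ln_exp ln_less_cancel_iff)
        then have "ln d / l < \<epsilon>"
          using l by (simp add: pos_divide_less_eq mult.commute)
        finally show False using dev by simp
      qed
      then have "ennreal (exp (- l * \<epsilon>)) * ennreal (exp (l * \<epsilon>)) \<le> ennreal (exp (- l * \<epsilon>)) * D \<omega>"
        by (rule mult_left_mono) simp
      then show "1 \<le> ennreal (exp (- l * \<epsilon>)) * D \<omega>"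
        by (simp flip: ennreal_mult exp_add)
    qed
    then have "outer_measure_of P ?A \<le> outer_measure_of P ?B"
      by (rule outer_measure_of_mono)
    also have "\<dots> = emeasure P ?B"
      using D(1) by (intro outer_measure_of_eq) measurable
    also have "\<dots> \<le> ennreal (exp (- l * \<epsilon>)) * (\<integral>\<^sup>+\<omega>. D \<omega> * indicator (space P) \<omega> \<partial>P)"
      using D(1) by (intro nn_integral_Markov_inequality) auto
    also have "(\<integral>\<^sup>+\<omega>. D \<omega> * indicator (space P) \<omega> \<partial>P) = (\<integral>\<^sup>+\<omega>. D \<omega> \<partial>P)"
      by (intro nn_integral_cong) simp
    also have "ennreal (exp (- l * \<epsilon>)) * (\<integral>\<^sup>+\<omega>. D \<omega> \<partial>P) \<le> ennreal (exp (- l * \<epsilon>)) * (ennreal ?C * ?I)"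
      by (intro mult_left_mono D(3)) simp
    also have "\<dots> = ?I * ennreal (exp (- l * \<epsilon>) * ?C)"
      by (simp only: ennreal_mult exp_ge_zero mult_ac)
    also have "\<dots> \<le> ?I * ennreal (exp (- ((\<epsilon> - 2 * \<alpha>)\<^sup>2 / (2 * M\<^sup>2 * (L2_set q {1..T})\<^sup>2))))"
      using exponent by (intro mult_left_mono ennreal_leI) (simp_all flip: exp_add)
    finally show "outer_measure_of P ?A \<le>
      ?I * ennreal (exp (- ((\<epsilon> - 2 * \<alpha>)\<^sup>2 / (2 * M\<^sup>2 * (L2_set q {1..T})\<^sup>2))))" .
  qed
qed

end
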